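(* Let $\Delta\sim \mathcal{U}(n)$, where $n$ is even. Then with high probability (i.e. with probability tending to $1$ as $n\to\infty$ through even integers), $\Delta$ has a complete $(n/2-2)$-skeleton.
   Context: A simplicial complex on $n$ vertices is a collection $\Delta$ of non-empty subsets of $[n]=\{1,\dots,n\}$ such that if $x\in\Delta$ and $\emptyset\neq y\subseteq x$ then $y\in\Delta$ (not every singleton need belong to $\Delta$). Its elements are called faces. $\mathcal{M}(n)$ is the set of all simplicial complexes on $n$ vertices, and $\mathcal{U}(n)$ is the uniform probability distribution on $\mathcal{M}(n)$. The $k$-skeleton of $\Delta$ is the complex formed by all faces of $\Delta$ of size (cardinality) at most $k$ (size, not dimension, is used here); $\Delta$ has a complete $k$-skeleton if every non-empty subset of $[n]$ of size at most $k$ is a face of $\Delta$. *)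

theory Defs
  imports "HOL-Probability.Probability"
begin

(* Faces are non-empty and not every vertex needs to be a face; in particular the
   empty collection is a simplicial complex. *)
definition simplicial_complex :: "nat \<Rightarrow> nat set set \<Rightarrow> bool" where
  "simplicial_complex n \<Delta> \<longleftrightarrow>
     (\<forall>x\<in>\<Delta>. x \<subseteq> {1..n} \<and> x \<noteq> {}) \<and>
     (\<forall>x y. x \<in> \<Delta> \<and> y \<noteq> {} \<and> y \<subseteq> x \<longrightarrow> y \<in> \<Delta>)"

definition complexes :: "nat \<Rightarrow> nat set set set" where
  "complexes n = {\<Delta>. simplicial_complex n \<Delta>}"

lemma finite_complexes: "finite (complexes n)"
proof (rule finite_subset)
  show "complexes n \<subseteq> Pow (Pow {1..n})"
    by (auto simp: complexes_def simplicial_complex_def)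
qed simp

lemma complexes_nonempty: "complexes n \<noteq> {}"
proof -
  have "{} \<in> complexes n"
    by (simp add: complexes_def simplicial_complex_def)
  then show ?thesis by blast
qed

definition uniform_complex :: "nat \<Rightarrow> nat set set pmf" where
  "uniform_complex n = pmf_of_set (complexes n)"

lemma set_pmf_uniform_complex: "set_pmf (uniform_complex n) = complexes n"
  by (simp add: uniform_complex_def finite_complexes complexes_nonempty)

(* The index k of a skeleton bounds the cardinality of the faces, not their dimension. *)
definition complete_skeleton :: "nat \<Rightarrow> nat \<Rightarrow> nat set set \<Rightarrow> bool" where
  "complete_skeleton n k \<Delta> \<longleftrightarrow>
     (\<forall>s. s \<subseteq> {1..n} \<and> s \<noteq> {} \<and> card s \<le> k \<longrightarrow> s \<in> \<Delta>)"

end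

(*
  Write n = 2h and N = (2h choose h), and let U be the up-set of non-faces. By the union bound it
  suffices that a fixed set A of size h - 2 lies in U with probability at most 2^(-2.1 h). By Harris'
  inequality the probability only grows if all sets of size greater than h are put into U. By Harris
  again, and by symmetry, if the bound failed then any m such sets A would simultaneously lie in U with
  probability at least 2^(-2.1 h m). Take m of the order of a small constant times N / h^2, so that the
  sets of size h above one of them make up a positive fraction r of the middle layer.

  On the other hand the number of such U is 2^(N - c N / h) with a larger c: summing over the layers of
  U from the middle downwards, each layer is controlled by Finner's inequality, with blocks formed by
  the sets of size j below a given set of size j + 2. The loss c has three sources: the sizes of two
  neighbouring layers differ by a factor of about 1 + 1/h (contributing r), the up-set must have a large
  boundary in the middle layer by the Poincare inequality for the Johnson graph (about 3/2 r), and the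
  sets directly above the chosen A are not free (2r). Their sum exceeds the 4.2 r available. There are
  at least 2^N up-sets in total, since the middle layer is free when nothing below it is in U.
*)
theory Submission
  imports Defs "HOL-Real_Asymp.Real_Asymp"
begin

section \<open>Correlation and product inequalities\<close>

text \<open>Counting cannot treat a single \<open>A\<close> directly: every block in Finner's
  inequality loses a polynomial factor, and over all layers these losses allow a factor 2^x with x
  of order N log h / h^(3/2), which swamps 2^(-2.1 h). Asking for about N / h^2 sets at once makes
  both sides exponentials in N / h, where such losses are negligible. The constant 2.1 has to exceed
  2 because the union bound runs over 2^(2h) sets up to a polynomial factor; with about 2 r N / h^2
  chosen sets it turns into 4.2 r. The layer ratio and the forced sets give only 3 r, so more than r
  must come from isoperimetry: a Poincare weight c contributes 4 c r, and c = 3/8 brings the total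
  to 9/2 r. Blocks reach two layers up because the sets below Z then are the edges of a graph on Z:
  the shadow shows as the non-isolated vertices, its Johnson boundary as the pairs of a non-isolated
  and an isolated vertex, and the graphs with given non-isolated vertices are easy to count.\<close>

lemma sum_Pow_insert:
  fixes f :: "'a set \<Rightarrow> 'b::comm_monoid_add"
  assumes "finite E" "e \<notin> E"
  shows "sum f (Pow (insert e E)) = (\<Sum>A\<in>Pow E. f A + f (insert e A))"
proof -
  have "sum f (Pow (insert e E)) = sum f (Pow E) + sum f (insert e ` Pow E)"
    unfolding Pow_insert using assms by (intro sum.union_disjoint) auto
  also have "sum f (insert e ` Pow E) = (\<Sum>A\<in>Pow E. f (insert e A))"
    using assms(2) by (intro sum.reindex_cong[OF _ refl refl]) (auto simp: inj_on_def)
  finally show ?thesis by (simp add: sum.distrib)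
qed

text \<open>The Ahlswede-Daykin inequality over a one-point ground set. Only the mixed terms need
  care: \<open>p\<close> and \<open>q\<close> are at most \<open>r\<close> and
  \<open>p * q \<le> r * (c0 * d1)\<close>, so \<open>(r - p) * (r - q) \<ge> 0\<close> gives
  \<open>p + q \<le> r + c0 * d1\<close>.\<close>

lemma four_functions_step:
  fixes a0 a1 b0 b1 c0 c1 d0 d1 :: real
  assumes nn: "a0 \<ge> 0" "a1 \<ge> 0" "b0 \<ge> 0" "b1 \<ge> 0" "c0 \<ge> 0" "c1 \<ge> 0" "d0 \<ge> 0" "d1 \<ge> 0"
    and 00: "a0 * b0 \<le> c0 * d0" and 01: "a0 * b1 \<le> c1 * d0"
    and 10: "a1 * b0 \<le> c1 * d0" and 11: "a1 * b1 \<le> c1 * d1"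
  shows "(a0 + a1) * (b0 + b1) \<le> (c0 + c1) * (d0 + d1)"
proof -
  define p q r where "p = a0 * b1" and "q = a1 * b0" and "r = c1 * d0"
  have r: "p \<le> r" "q \<le> r" "0 \<le> p" "0 \<le> q"
    using assms by (auto simp: p_def q_def r_def)
  have "p * q = (a0 * b0) * (a1 * b1)"
    by (simp add: p_def q_def)
  also have "\<dots> \<le> (c0 * d0) * (c1 * d1)"
    using nn by (intro mult_mono 00 11) auto
  also have "\<dots> = r * (c0 * d1)"
    by (simp add: r_def)
  finally have pq: "p * q \<le> r * (c0 * d1)" .
  have "p + q \<le> r + c0 * d1"
  proof (cases "r = 0")
    case True
    with r have "p = 0" "q = 0" by auto
    then show ?thesis using nn by (simp add: True)
  next
    case False
    with r have "r > 0" by linarith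
    have "0 \<le> (r - p) * (r - q)" using r by simp
    then have "r * (p + q) \<le> r * r + p * q" by (simp add: algebra_simps)
    also have "\<dots> \<le> r * (r + c0 * d1)" using pq by (simp add: algebra_simps)
    finally show ?thesis using \<open>r > 0\<close> by simp
  qed
  then show ?thesis
    using 00 11 by (simp add: p_def q_def r_def algebra_simps)
qed

text \<open>The Ahlswede-Daykin theorem. Summing each function over the two choices for one point
  preserves the hypothesis by the one-point case, so points can be removed inductively.\<close>

theorem four_functions:
  fixes \<alpha> \<beta> \<gamma> \<delta> :: "'a set \<Rightarrow> real"
  assumes "finite E"
    and "\<And>A. \<alpha> A \<ge> 0" "\<And>A. \<beta> A \<ge> 0" "\<And>A. \<gamma> A \<ge> 0" "\<And>A. \<delta> A \<ge> 0"
    and "\<And>A B. A \<subseteq> E \<Longrightarrow> B \<subseteq> E \<Longrightarrow> \<alpha> A * \<beta> B \<le> \<gamma> (A \<union> B) * \<delta> (A \<inter> B)"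
  shows "sum \<alpha> (Pow E) * sum \<beta> (Pow E) \<le> sum \<gamma> (Pow E) * sum \<delta> (Pow E)"
  using assms
proof (induction E arbitrary: \<alpha> \<beta> \<gamma> \<delta> rule: finite_induct)
  case empty
  then show ?case by simp
next
  case (insert e E)
  note nn = insert.prems(1-4) and le = insert.prems(5)
  let ?ext = "\<lambda>f A. f A + (f (Set.insert e A) :: real)"
  have "sum (?ext \<alpha>) (Pow E) * sum (?ext \<beta>) (Pow E) \<le> sum (?ext \<gamma>) (Pow E) * sum (?ext \<delta>) (Pow E)"
  proof (rule insert.IH)
    fix A B assume AB: "A \<subseteq> E" "B \<subseteq> E"
    then have e: "e \<notin> A" "e \<notin> B" using insert.hyps by auto
    let ?i = "Set.insert e"
    have sub: "A \<subseteq> ?i E" "B \<subseteq> ?i E" "?i A \<subseteq> ?i E" "?i B \<subseteq> ?i E" using AB by auto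
    have int: "A \<inter> ?i B = A \<inter> B" "?i A \<inter> B = A \<inter> B" using e by auto
    show "?ext \<alpha> A * ?ext \<beta> B \<le> ?ext \<gamma> (A \<union> B) * ?ext \<delta> (A \<inter> B)"
      using le[OF sub(1) sub(2)] le[OF sub(1) sub(4)] le[OF sub(3) sub(2)] le[OF sub(3) sub(4)] int
      by (intro four_functions_step nn) auto
  qed (use nn in \<open>auto intro: add_nonneg_nonneg\<close>)
  then show ?case
    using insert.hyps by (simp add: sum_Pow_insert)
qed

text \<open>Four functions theorem for indicators: if \<open>A\<close> satisfies \<open>P\<close>
  and \<open>B\<close> satisfies \<open>Q\<close>, then \<open>A \<union> B\<close> satisfies both
  and \<open>A \<inter> B\<close> stays in the lattice. The lattice is left general because it will
  be the lattice of up-sets, whose members are themselves families of sets.\<close>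

lemma harris_upsets:
  fixes \<L> :: "'a set set"
  assumes fin: "finite (\<Union>\<L>)"
    and Un: "\<And>A B. A \<in> \<L> \<Longrightarrow> B \<in> \<L> \<Longrightarrow> A \<union> B \<in> \<L>"
    and Int: "\<And>A B. A \<in> \<L> \<Longrightarrow> B \<in> \<L> \<Longrightarrow> A \<inter> B \<in> \<L>"
    and up1: "\<And>A B. A \<in> \<L> \<Longrightarrow> B \<in> \<L> \<Longrightarrow> P A \<Longrightarrow> A \<subseteq> B \<Longrightarrow> P B"
    and up2: "\<And>A B. A \<in> \<L> \<Longrightarrow> B \<in> \<L> \<Longrightarrow> Q A \<Longrightarrow> A \<subseteq> B \<Longrightarrow> Q B"
  shows "card {A\<in>\<L>. P A} * card {A\<in>\<L>. Q A} \<le> card {A\<in>\<L>. P A \<and> Q A} * card \<L>"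
proof -
  let ?E = "\<Union>\<L>"
  have card_eq: "sum (indicator \<A>) (Pow ?E) = real (card \<A>)" if "\<A> \<subseteq> \<L>" for \<A>
  proof -
    have "Pow ?E \<inter> \<A> = \<A>" using that by auto
    then show ?thesis using fin by (simp add: indicator_def sum.If_cases)
  qed
  have "sum (indicator {A\<in>\<L>. P A}) (Pow ?E) * sum (indicator {A\<in>\<L>. Q A}) (Pow ?E)
      \<le> (sum (indicator {A\<in>\<L>. P A \<and> Q A}) (Pow ?E) * sum (indicator \<L>) (Pow ?E) :: real)"
  proof (rule four_functions[OF fin])
    fix A B
    show "indicator {A\<in>\<L>. P A} A * indicator {A\<in>\<L>. Q A} B
      \<le> (indicator {A\<in>\<L>. P A \<and> Q A} (A \<union> B) * indicator \<L> (A \<inter> B) :: real)"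
      using Un[of A B] Int[of A B] up1[of A "A \<union> B"] up2[of B "A \<union> B"]
      by (auto simp: indicator_def)
  qed auto
  then have "real (card {A\<in>\<L>. P A} * card {A\<in>\<L>. Q A}) \<le> real (card {A\<in>\<L>. P A \<and> Q A} * card \<L>)"
    by (simp add: card_eq)
  then show ?thesis by (simp only: of_nat_le_iff)
qed

text \<open>The events \<open>i \<in> A\<close> and their intersections are all increasing, so
  Harris can be iterated. This is the amplification from one rare event to many simultaneous
  ones.\<close>

lemma harris_upsets_prod:
  fixes \<L> :: "'a set set"
  assumes fin: "finite (\<Union>\<L>)" and ne: "\<L> \<noteq> {}"
    and Un: "\<And>A B. A \<in> \<L> \<Longrightarrow> B \<in> \<L> \<Longrightarrow> A \<union> B \<in> \<L>"
    and Int: "\<And>A B. A \<in> \<L> \<Longrightarrow> B \<in> \<L> \<Longrightarrow> A \<inter> B \<in> \<L>"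
    and "finite I"
  shows "(\<Prod>i\<in>I. card {A\<in>\<L>. i \<in> A} / card \<L>) \<le> card {A\<in>\<L>. I \<subseteq> A} / card \<L>"
  using \<open>finite I\<close>
proof (induction I)
  case empty
  have "finite \<L>" using fin by (rule finite_UnionD)
  then show ?case using ne by simp
next
  case (insert i I)
  have pos: "card \<L> > 0" using finite_UnionD[OF fin] ne by (simp add: card_gt_0_iff)
  have "(\<Prod>i\<in>insert i I. card {A\<in>\<L>. i \<in> A} / card \<L>)
      \<le> card {A\<in>\<L>. i \<in> A} / card \<L> * (card {A\<in>\<L>. I \<subseteq> A} / card \<L>)"
    using insert.IH unfolding prod.insert[OF insert.hyps] by (intro mult_left_mono) auto
  also have "\<dots> = real (card {A\<in>\<L>. i \<in> A} * card {A\<in>\<L>. I \<subseteq> A}) / (real (card \<L>))\<^sup>2"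
    by (simp add: power2_eq_square)
  also have "\<dots> \<le> real (card {A\<in>\<L>. i \<in> A \<and> I \<subseteq> A} * card \<L>) / (real (card \<L>))\<^sup>2"
    by (intro divide_right_mono of_nat_mono harris_upsets[OF fin Un Int]) auto
  also have "\<dots> = card {A\<in>\<L>. insert i I \<subseteq> A} / card \<L>"
    using pos by (simp add: power2_eq_square)
  finally show ?case .
qed

section \<open>The inequalities of Hoelder and Finner\<close>

lemma powr_prod:
  fixes f :: "'i \<Rightarrow> real"
  assumes "\<And>i. i \<in> I \<Longrightarrow> f i \<ge> 0"
  shows "(\<Prod>i\<in>I. f i powr p) = (\<Prod>i\<in>I. f i) powr p"
  using assms by (induction I rule: infinite_finite_induct) (auto simp: powr_mult prod_nonneg)

lemma prod_powr_le_average: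
  fixes f :: "'i \<Rightarrow> real"
  assumes "finite I" "I \<noteq> {}" "\<And>i. i \<in> I \<Longrightarrow> f i \<ge> 0"
  shows "(\<Prod>i\<in>I. f i powr (1 / card I)) \<le> (\<Sum>i\<in>I. f i) / card I"
  using arith_geom_mean[of I f] assms by (simp add: powr_prod sum_divide_distrib)

text \<open>Hoelder's inequality with \<open>k\<close> equal exponents. After division by the right
  side, AM-GM bounds each product by an average of ratios, and the two ratios belonging to
  \<open>i\<close> add up to 1.\<close>

lemma holder_two_points:
  fixes a b :: "'i \<Rightarrow> real"
  assumes I: "finite I" "card I = k" "k > 0"
    and nn: "\<And>i. i \<in> I \<Longrightarrow> a i \<ge> 0" "\<And>i. i \<in> I \<Longrightarrow> b i \<ge> 0"
  shows "(\<Prod>i\<in>I. a i powr (1/k)) + (\<Prod>i\<in>I. b i powr (1/k)) \<le> (\<Prod>i\<in>I. (a i + b i) powr (1/k))"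
proof (cases "\<forall>i\<in>I. a i + b i > 0")
  case False
  then obtain i where i: "i \<in> I" "\<not> a i + b i > 0" by auto
  with nn[of i] have "a i = 0" "b i = 0" by linarith+
  then have "(\<Prod>i\<in>I. a i powr (1/k)) = 0" "(\<Prod>i\<in>I. b i powr (1/k)) = 0"
    using i I by (auto intro!: bexI[of _ i])
  then show ?thesis by (simp add: prod_nonneg)
next
  case True
  have ne: "I \<noteq> {}" using I by auto
  let ?c = "\<Prod>i\<in>I. (a i + b i) powr (1/k)"
  have c: "?c > 0" using True by (intro prod_pos) auto
  have ratio: "(\<Prod>i\<in>I. x i powr (1/k)) / ?c \<le> (\<Sum>i\<in>I. x i / (a i + b i)) / k"
    if "\<And>i. i \<in> I \<Longrightarrow> x i \<ge> 0" for x
  proof -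
    have "(\<Prod>i\<in>I. x i powr (1/k)) / ?c = (\<Prod>i\<in>I. (x i / (a i + b i)) powr (1/k))"
      using that True by (auto simp: prod_dividef[symmetric] powr_divide less_imp_le intro!: prod.cong)
    also have "\<dots> \<le> (\<Sum>i\<in>I. x i / (a i + b i)) / k"
      using prod_powr_le_average[of I "\<lambda>i. x i / (a i + b i)"] that True I ne
      by (auto simp: less_imp_le)
    finally show ?thesis .
  qed
  have "((\<Prod>i\<in>I. a i powr (1/k)) + (\<Prod>i\<in>I. b i powr (1/k))) / ?c
      \<le> (\<Sum>i\<in>I. a i / (a i + b i)) / k + (\<Sum>i\<in>I. b i / (a i + b i)) / k"
    unfolding add_divide_distrib using nn by (intro add_mono ratio)
  also have "\<dots> = (\<Sum>i\<in>I. a i / (a i + b i) + b i / (a i + b i)) / k"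
    by (simp add: sum.distrib add_divide_distrib)
  also have "(\<Sum>i\<in>I. a i / (a i + b i) + b i / (a i + b i)) = (\<Sum>i\<in>I. 1)"
    using True by (intro sum.cong) (auto simp: add_divide_distrib[symmetric])
  also have "\<dots> / k = 1" using I by simp
  finally show ?thesis using c by (simp add: divide_le_eq)
qed

text \<open>Points of \<open>V\<close> are summed out one at a time. Only the \<open>k\<close>
  blocks containing \<open>v\<close> depend on it, and Hoelder with exponents \<open>1/k\<close>
  moves the sum over \<open>v\<close> inside each of them, which turns \<open>G\<close> into
  \<open>G'\<close>.\<close>

theorem finner_inequality:
  fixes B :: "'i \<Rightarrow> 'v set" and G :: "'i \<Rightarrow> 'v set \<Rightarrow> real"
  assumes "finite V" "finite I" "k > 0"
    and "\<And>v. v \<in> V \<Longrightarrow> card {i\<in>I. v \<in> B i} = k"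
    and "\<And>i y. G i y \<ge> 0"
  shows "(\<Sum>x\<in>Pow V. \<Prod>i\<in>I. G i (x \<inter> B i) powr (1/k))
       \<le> (\<Prod>i\<in>I. (\<Sum>y\<in>Pow (V \<inter> B i). G i y) powr (1/k))"
  using assms(1,4,5)
proof (induction V arbitrary: G rule: finite_induct)
  case empty
  then show ?case by simp
next
  case (insert v V)
  note deg = insert.prems(1) and nn = insert.prems(2)
  define J where "J = {i\<in>I. v \<in> B i}"
  define G' where "G' = (\<lambda>i y. if v \<in> B i then G i y + G i (Set.insert v y) else G i y)"
  have J: "finite J" "card J = k" "J \<subseteq> I" using \<open>finite I\<close> deg[of v] by (auto simp: J_def)
  have split: "(\<Prod>i\<in>I. g i) = (\<Prod>i\<in>I-J. g i) * (\<Prod>i\<in>J. g i)" for g :: "'i \<Rightarrow> real"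
    using J \<open>finite I\<close> by (metis prod.subset_diff)
  have point: "(\<Prod>i\<in>I. G i (x \<inter> B i) powr (1/k)) + (\<Prod>i\<in>I. G i (Set.insert v x \<inter> B i) powr (1/k))
     \<le> (\<Prod>i\<in>I. G' i (x \<inter> B i) powr (1/k))" if x: "x \<in> Pow V" for x
  proof -
    let ?R = "\<Prod>i\<in>I-J. G i (x \<inter> B i) powr (1/k)"
    have "(\<Prod>i\<in>I. G i (Set.insert v x \<inter> B i) powr (1/k))
      = ?R * (\<Prod>i\<in>J. G i (Set.insert v (x \<inter> B i)) powr (1/k))"
      unfolding split by (intro arg_cong2[where f="(*)"] prod.cong) (auto simp: J_def)
    then have "(\<Prod>i\<in>I. G i (x \<inter> B i) powr (1/k)) + (\<Prod>i\<in>I. G i (Set.insert v x \<inter> B i) powr (1/k))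
      = ?R * ((\<Prod>i\<in>J. G i (x \<inter> B i) powr (1/k)) + (\<Prod>i\<in>J. G i (Set.insert v (x \<inter> B i)) powr (1/k)))"
      by (simp add: split algebra_simps)
    also have "\<dots> \<le> ?R * (\<Prod>i\<in>J. (G i (x \<inter> B i) + G i (Set.insert v (x \<inter> B i))) powr (1/k))"
      using nn J \<open>k > 0\<close> by (intro mult_left_mono holder_two_points prod_nonneg) auto
    also have "\<dots> = (\<Prod>i\<in>I. G' i (x \<inter> B i) powr (1/k))"
      unfolding split by (intro arg_cong2[where f="(*)"] prod.cong) (auto simp: J_def G'_def)
    finally show ?thesis .
  qed
  have "(\<Sum>x\<in>Pow (Set.insert v V). \<Prod>i\<in>I. G i (x \<inter> B i) powr (1/k))
      \<le> (\<Sum>x\<in>Pow V. \<Prod>i\<in>I. G' i (x \<inter> B i) powr (1/k))"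
    unfolding sum_Pow_insert[OF insert.hyps] by (intro sum_mono point)
  also have "\<dots> \<le> (\<Prod>i\<in>I. (\<Sum>y\<in>Pow (V \<inter> B i). G' i y) powr (1/k))"
    using deg nn by (intro insert.IH) (auto simp: G'_def intro: add_nonneg_nonneg)
  also have "\<dots> = (\<Prod>i\<in>I. (\<Sum>y\<in>Pow (Set.insert v V \<inter> B i). G i y) powr (1/k))"
  proof (intro prod.cong refl arg_cong2[where f="(powr)"])
    fix i
    show "(\<Sum>y\<in>Pow (V \<inter> B i). G' i y) = (\<Sum>y\<in>Pow (Set.insert v V \<inter> B i). G i y)"
    proof (cases "v \<in> B i")
      case True
      then have "Set.insert v V \<inter> B i = Set.insert v (V \<inter> B i)" by auto
      then show ?thesis
        using insert.hyps True by (simp add: sum_Pow_insert G'_def)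
    qed (simp add: G'_def)
  qed
  finally show ?case .
qed

section \<open>Layers of the Boolean lattice\<close>

definition layer :: "'a set \<Rightarrow> nat \<Rightarrow> 'a set set" where
  "layer E j = {S. S \<subseteq> E \<and> card S = j}"

definition upper_shadow :: "'a set \<Rightarrow> 'a set set \<Rightarrow> 'a set set" where
  "upper_shadow E V = {Y. Y \<subseteq> E \<and> (\<exists>X\<in>V. X \<subseteq> Y \<and> card Y = Suc (card X))}"

text \<open>For \<open>V\<close> in layer \<open>j\<close> and \<open>Z\<close> in layer \<open>j + 2\<close>, the pairs \<open>Z - X\<close> are the edges of a graph on \<open>Z\<close>,
  and \<open>cover V Z\<close> is its set of non-isolated vertices; \<open>a\<close> is one of them iff \<open>Z - {a}\<close> lies in the
  upper shadow of \<open>V\<close>.\<close>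

definition cover :: "'a set set \<Rightarrow> 'a set \<Rightarrow> 'a set" where
  "cover V Z = (\<Union>X\<in>{X\<in>V. X \<subseteq> Z}. Z - X)"

lemma finite_layer [simp]: "finite E \<Longrightarrow> finite (layer E j)"
  by (simp add: layer_def)

lemma card_layer [simp]: "finite E \<Longrightarrow> card (layer E j) = card E choose j"
  by (simp add: layer_def n_subsets)

lemma finite_upper_shadow [simp]: "finite E \<Longrightarrow> finite (upper_shadow E V)"
  by (simp add: upper_shadow_def)

lemma upper_shadow_mono: "V \<subseteq> W \<Longrightarrow> upper_shadow E V \<subseteq> upper_shadow E W"
  by (auto simp: upper_shadow_def)

lemma upper_shadow_subset_layer:
  assumes "V \<subseteq> layer E j"
  shows "upper_shadow E V \<subseteq> layer E (Suc j)"
  using assms by (auto simp: upper_shadow_def layer_def)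

lemma cover_subset: "cover V Z \<subseteq> Z"
  by (auto simp: cover_def)

lemma cover_mono: "V \<subseteq> W \<Longrightarrow> cover V Z \<subseteq> cover W Z"
  by (auto simp: cover_def)

lemma cover_restrict: "cover (V \<inter> {X. X \<subseteq> Z}) Z = cover V Z"
  by (auto simp: cover_def)

lemma finite_layer_mem: "finite E \<Longrightarrow> S \<in> layer E j \<Longrightarrow> finite S"
  by (auto simp: layer_def intro: finite_subset)

lemma card_layer_supersets:
  assumes "finite E" "Y \<subseteq> E"
  shows "card {Z\<in>layer E (card Y + m). Y \<subseteq> Z} = (card E - card Y) choose m"
proof -
  have fY: "finite Y" using assms finite_subset by blast
  have "bij_betw (\<lambda>Z. Z - Y) {Z\<in>layer E (card Y + m). Y \<subseteq> Z} (layer (E - Y) m)"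
  proof (rule bij_betwI[where g = "\<lambda>S. S \<union> Y"])
    show "(\<lambda>Z. Z - Y) \<in> {Z\<in>layer E (card Y + m). Y \<subseteq> Z} \<rightarrow> layer (E - Y) m"
      using fY by (auto simp: layer_def card_Diff_subset)
    show "(\<lambda>S. S \<union> Y) \<in> layer (E - Y) m \<rightarrow> {Z\<in>layer E (card Y + m). Y \<subseteq> Z}"
    proof
      fix S assume S: "S \<in> layer (E - Y) m"
      then have "finite S" "S \<inter> Y = {}" using assms by (auto simp: layer_def intro: finite_subset)
      then show "S \<union> Y \<in> {Z\<in>layer E (card Y + m). Y \<subseteq> Z}"
        using S fY assms by (auto simp: layer_def card_Un_disjoint)
    qed
  qed (auto simp: layer_def)
  then have "card {Z\<in>layer E (card Y + m). Y \<subseteq> Z} = card (layer (E - Y) m)"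
    by (rule bij_betw_same_card)
  then show ?thesis using assms fY by (simp add: card_Diff_subset)
qed

lemma mem_cover_iff:
  assumes "finite E" "V \<subseteq> layer E j" "Z \<in> layer E (j + 2)"
  shows "a \<in> cover V Z \<longleftrightarrow> a \<in> Z \<and> Z - {a} \<in> upper_shadow E V"
proof -
  have fZ: "finite Z" "Z \<subseteq> E" "card Z = j + 2" using assms finite_subset by (auto simp: layer_def)
  have "a \<in> cover V Z \<longleftrightarrow> a \<in> Z \<and> (\<exists>X\<in>V. X \<subseteq> Z - {a})"
    by (auto simp: cover_def)
  also have "\<dots> \<longleftrightarrow> a \<in> Z \<and> (\<exists>X\<in>V. X \<subseteq> Z - {a} \<and> card (Z - {a}) = Suc (card X))"
  proof (cases "a \<in> Z")
    case True
    then have "card (Z - {a}) = Suc j" using fZ by simp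
    moreover have "card X = j" if "X \<in> V" for X using that assms(2) by (auto simp: layer_def)
    ultimately show ?thesis by simp
  qed simp
  also have "(\<exists>X\<in>V. X \<subseteq> Z - {a} \<and> card (Z - {a}) = Suc (card X)) \<longleftrightarrow> Z - {a} \<in> upper_shadow E V"
  proof -
    have "Z - {a} \<subseteq> E" using fZ(2) by auto
    then show ?thesis by (simp only: upper_shadow_def mem_Collect_eq simp_thms)
  qed
  finally show ?thesis .
qed

text \<open>Double counting of the pairs (Z, a) with \<open>Z - {a}\<close> in the shadow: a set Y
  of the shadow arises once from each point outside it. The size of the shadow thereby splits into
  contributions of the blocks.\<close>

lemma sum_card_cover:
  assumes "finite E" "V \<subseteq> layer E j"
  shows "(\<Sum>Z\<in>layer E (j + 2). card (cover V Z)) = (card E - Suc j) * card (upper_shadow E V)"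
proof -
  let ?D = "upper_shadow E V"
  have D: "Y \<subseteq> E" "card Y = Suc j" "finite Y" if "Y \<in> ?D" for Y
    using that upper_shadow_subset_layer[OF assms(2)] assms(1) finite_layer_mem
    by (auto simp: layer_def intro: finite_subset)
  have finc: "finite (cover V Z)" if "Z \<in> layer E (j + 2)" for Z
    using that assms by (meson cover_subset finite_layer_mem finite_subset)
  have "bij_betw (\<lambda>(Z, a). (Z - {a}, a)) (SIGMA Z:layer E (j + 2). cover V Z) (SIGMA Y:?D. E - Y)"
  proof (rule bij_betwI[where g = "\<lambda>(Y, a). (insert a Y, a)"])
    show "(\<lambda>(Z, a). (Z - {a}, a)) \<in> (SIGMA Z:layer E (j + 2). cover V Z) \<rightarrow> (SIGMA Y:?D. E - Y)"
      using mem_cover_iff[OF assms] by (auto simp: layer_def)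
    show "(\<lambda>(Y, a). (insert a Y, a)) \<in> (SIGMA Y:?D. E - Y) \<rightarrow> (SIGMA Z:layer E (j + 2). cover V Z)"
    proof (clarsimp, intro conjI)
      fix Y a assume Y: "Y \<in> ?D" "a \<in> E" "a \<notin> Y"
      then show *: "insert a Y \<in> layer E (Suc (Suc j))" using D[OF Y(1)] by (auto simp: layer_def)
      show "a \<in> cover V (insert a Y)"
        using mem_cover_iff[OF assms, of "insert a Y" a] Y * by simp
    qed
    show "(\<lambda>(Y, a). (insert a Y, a)) ((\<lambda>(Z, a). (Z - {a}, a)) x) = x"
      if "x \<in> (SIGMA Z:layer E (j + 2). cover V Z)" for x
      using that cover_subset[of V] by auto
    show "(\<lambda>(Z, a). (Z - {a}, a)) ((\<lambda>(Y, a). (insert a Y, a)) x) = x"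
      if "x \<in> (SIGMA Y:?D. E - Y)" for x
      using that by auto
  qed
  then have "card (SIGMA Z:layer E (j + 2). cover V Z) = card (SIGMA Y:?D. E - Y)"
    by (rule bij_betw_same_card)
  also have "\<dots> = (\<Sum>Y\<in>?D. card (E - Y))"
    using assms(1) by (intro card_SigmaI) auto
  also have "\<dots> = (\<Sum>Y\<in>?D. card E - Suc j)"
    using D assms(1) by (intro sum.cong) (auto simp: card_Diff_subset)
  finally show ?thesis using assms(1) finc by (simp add: card_SigmaI mult.commute)
qed

text \<open>For \<open>G\<close> inside layer \<open>h\<close>, \<open>card (Y - Y')\<close> is the
  distance in the Johnson graph; \<open>d = 1\<close> gives the edge boundary of \<open>G\<close>.
  Larger \<open>d\<close> serves the proof of the Poincare inequality.\<close>

definition johnson_pairs :: "'a set \<Rightarrow> nat \<Rightarrow> nat \<Rightarrow> 'a set set \<Rightarrow> ('a set \<times> 'a set) set" where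
  "johnson_pairs E h d G = {(Y, Y'). Y \<in> G \<and> Y' \<in> layer E h - G \<and> card (Y - Y') = d}"

text \<open>A boundary edge (Y, Y') determines Z as the union of Y and Y', together with the points
  \<open>a\<close>, \<open>b\<close> whose removal gives Y and Y'. Here \<open>a\<close> is covered
  and \<open>b\<close> is not, so the boundary splits over the blocks.\<close>

lemma sum_cover_boundary:
  assumes "finite E" "V \<subseteq> layer E j"
  shows "(\<Sum>Z\<in>layer E (j + 2). card (cover V Z) * (j + 2 - card (cover V Z)))
    = card (johnson_pairs E (Suc j) 1 (upper_shadow E V))"
proof -
  let ?D = "upper_shadow E V"
  have D: "Y \<subseteq> E" "card Y = Suc j" "finite Y" if "Y \<in> ?D" for Y
    using that upper_shadow_subset_layer[OF assms(2)] assms(1) finite_layer_mem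
    by (auto simp: layer_def intro: finite_subset)
  let ?A = "SIGMA Z:layer E (j + 2). cover V Z \<times> (Z - cover V Z)"
  let ?f = "\<lambda>(Z, a, b). (Z - {a}, Z - {b})"
  have inj: "inj_on ?f ?A"
  proof (rule inj_onI, clarsimp)
    fix Z a b Z' a' b'
    assume ab: "a \<in> cover V Z" "b \<in> Z" "b \<notin> cover V Z" "a' \<in> cover V Z'" "b' \<in> Z'" "b' \<notin> cover V Z'"
      and eq: "Z - {a} = Z' - {a'}" "Z - {b} = Z' - {b'}"
    have "a \<noteq> b" "a' \<noteq> b'" "a \<in> Z" "a' \<in> Z'" using ab cover_subset[of V] by auto
    then have "Z = (Z - {a}) \<union> (Z - {b})" "Z' = (Z' - {a'}) \<union> (Z' - {b'})" by auto
    then have "Z = Z'" using eq by simp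
    then show "Z = Z' \<and> a = a' \<and> b = b'" using eq ab \<open>a \<in> Z\<close> \<open>a' \<in> Z'\<close> by auto
  qed
  have img: "?f ` ?A = johnson_pairs E (Suc j) 1 ?D"
  proof (intro equalityI subsetI)
    fix p assume "p \<in> ?f ` ?A"
    then obtain Z a b where Z: "Z \<in> layer E (j + 2)" and a: "a \<in> cover V Z"
      and b: "b \<in> Z" "b \<notin> cover V Z" and p: "p = (Z - {a}, Z - {b})"
      by auto
    have "a \<noteq> b" "a \<in> Z" using a b cover_subset[of V Z] by auto
    then have "(Z - {a}) - (Z - {b}) = {b}" using b by auto
    then show "p \<in> johnson_pairs E (Suc j) 1 ?D"
      using mem_cover_iff[OF assms Z] Z a b p finite_layer_mem[OF assms(1) Z]
      by (auto simp: johnson_pairs_def layer_def)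
  next
    fix p assume "p \<in> johnson_pairs E (Suc j) 1 ?D"
    then obtain Y Y' where p: "p = (Y, Y')" and Y: "Y \<in> ?D" and Y': "Y' \<in> layer E (Suc j)" "Y' \<notin> ?D"
      and d: "card (Y - Y') = 1"
      by (auto simp: johnson_pairs_def)
    note DY = D[OF Y]
    have fY': "finite Y'" using Y' assms finite_layer_mem by blast
    have "card Y = card (Y \<inter> Y') + card (Y - Y')" "card Y' = card (Y' \<inter> Y) + card (Y' - Y)"
      using DY fY' by (rule_tac card_Int_Diff; simp)+
    then have d': "card (Y' - Y) = 1" using d DY Y' by (simp add: layer_def Int_commute)
    from d obtain b where b: "Y - Y' = {b}" by (auto simp: card_1_singleton_iff)
    from d' obtain a where a: "Y' - Y = {a}" by (auto simp: card_1_singleton_iff)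
    define Z where "Z = insert a Y"
    have ab: "a \<notin> Y" "a \<in> Y'" "b \<in> Y" "b \<notin> Y'" using a b by auto
    have Z: "Z \<in> layer E (j + 2)" using DY Y' ab by (auto simp: Z_def layer_def)
    have "Z - {a} = Y" "Z - {b} = Y'" using a b by (auto simp: Z_def)
    moreover have "a \<in> Z" "b \<in> Z" using ab by (auto simp: Z_def)
    ultimately have "(Z, a, b) \<in> ?A" "p = ?f (Z, a, b)"
      using mem_cover_iff[OF assms Z] Z Y Y' p by auto
    then show "p \<in> ?f ` ?A" by blast
  qed
  have "card (johnson_pairs E (Suc j) 1 ?D) = card ?A"
    unfolding img[symmetric] by (rule card_image[OF inj])
  also have "\<dots> = (\<Sum>Z\<in>layer E (j + 2). card (cover V Z \<times> (Z - cover V Z)))"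
    using assms(1) by (intro card_SigmaI) (auto dest: finite_layer_mem intro: finite_subset[OF cover_subset])
  also have "\<dots> = (\<Sum>Z\<in>layer E (j + 2). card (cover V Z) * (j + 2 - card (cover V Z)))"
  proof (intro sum.cong refl)
    fix Z assume Z: "Z \<in> layer E (j + 2)"
    have "finite (cover V Z)" using Z assms by (meson cover_subset finite_layer_mem finite_subset)
    then show "card (cover V Z \<times> (Z - cover V Z)) = card (cover V Z) * (j + 2 - card (cover V Z))"
      using Z by (simp add: card_cartesian_product card_Diff_subset[OF _ cover_subset] layer_def)
  qed
  finally show ?thesis by simp
qed

lemma card_interval_sets:
  assumes "finite P" "F \<subseteq> P"
  shows "card {y. F \<subseteq> y \<and> y \<subseteq> P} = 2 ^ (card P - card F)"
proof -
  have "bij_betw (\<lambda>y. y - F) {y. F \<subseteq> y \<and> y \<subseteq> P} (Pow (P - F))"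
    by (rule bij_betwI[where g = "\<lambda>y. y \<union> F"]) (use assms in auto)
  then have "card {y. F \<subseteq> y \<and> y \<subseteq> P} = card (Pow (P - F))"
    by (rule bij_betw_same_card)
  then show ?thesis
    using assms by (simp add: card_Pow card_Diff_subset finite_subset)
qed


text \<open>If \<open>S\<close> is the set of non-isolated vertices, all edges lie inside
  \<open>S\<close>; the edges coming from \<open>F\<close> are fixed, and each of the others is at
  most a free binary choice.\<close>

lemma card_cover_fibre:
  assumes "finite Z" "F \<subseteq> Pow Z" "\<And>X. X \<in> F \<Longrightarrow> card X + 2 = card Z"
  shows "real (card {y. F \<subseteq> y \<and> y \<subseteq> {X. X \<subseteq> Z \<and> card X + 2 = card Z} \<and> cover y Z = S})
    \<le> 2 powr (real (card S choose 2) - card F)"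
proof (cases "{y. F \<subseteq> y \<and> y \<subseteq> {X. X \<subseteq> Z \<and> card X + 2 = card Z} \<and> cover y Z = S} = {}")
  case True
  then show ?thesis by (simp only: card.empty) simp
next
  case False
  define P where "P = {X. X \<subseteq> Z \<and> card X + 2 = card Z \<and> Z - X \<subseteq> S}"
  from False obtain y where y: "F \<subseteq> y" "cover y Z = S" by auto
  then have S: "S \<subseteq> Z" "finite S" using cover_subset[of y Z] assms(1) finite_subset by auto
  have finP: "finite P" using assms(1) by (auto simp: P_def intro: finite_subset[of _ "Pow Z"])
  have sub: "{y. F \<subseteq> y \<and> y \<subseteq> {X. X \<subseteq> Z \<and> card X + 2 = card Z} \<and> cover y Z = S}
    \<subseteq> {y. F \<subseteq> y \<and> y \<subseteq> P}"
    by (auto simp: cover_def P_def)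
  have FP: "F \<subseteq> P" using sub False by auto
  have "bij_betw (\<lambda>X. Z - X) P (layer S 2)"
  proof (rule bij_betwI[where g = "\<lambda>X. Z - X"])
    show "(\<lambda>X. Z - X) \<in> P \<rightarrow> layer S 2"
      using assms(1) by (auto simp: P_def layer_def card_Diff_subset finite_subset)
    show "(\<lambda>X. Z - X) \<in> layer S 2 \<rightarrow> P"
    proof
      fix T assume T: "T \<in> layer S 2"
      then have "T \<subseteq> Z" "card T = 2" "finite T" using S finite_subset by (auto simp: layer_def)
      moreover from this have "card T \<le> card Z" using assms(1) card_mono by blast
      ultimately show "Z - T \<in> P"
        using T by (auto simp: P_def layer_def card_Diff_subset)
    qed
  qed (use S in \<open>auto simp: P_def layer_def\<close>)
  then have cP: "card P = card S choose 2"
    using S by (auto dest!: bij_betw_same_card)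
  have "card {y. F \<subseteq> y \<and> y \<subseteq> {X. X \<subseteq> Z \<and> card X + 2 = card Z} \<and> cover y Z = S}
    \<le> card {y. F \<subseteq> y \<and> y \<subseteq> P}"
  proof (rule card_mono[OF _ sub])
    show "finite {y. F \<subseteq> y \<and> y \<subseteq> P}"
      by (rule finite_subset[of _ "Pow P"]) (auto simp: finP)
  qed
  also have "\<dots> = 2 ^ (card P - card F)" by (rule card_interval_sets[OF finP FP])
  finally have "real (card {y. F \<subseteq> y \<and> y \<subseteq> {X. X \<subseteq> Z \<and> card X + 2 = card Z} \<and> cover y Z = S})
    \<le> real (2 ^ (card P - card F))" by (rule of_nat_mono)
  also have "\<dots> = 2 powr (real (card P) - card F)"
    unfolding of_nat_diff[OF card_mono[OF finP FP], symmetric] by (subst powr_realpow) auto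
  finally show ?thesis by (simp add: cP)
qed

text \<open>Finner's inequality with one block \<open>{X. X \<subseteq> Z}\<close> for each \<open>Z\<close> in layer \<open>j + 2\<close>. Grouping the graphs on \<open>Z\<close>
  by their set \<open>S\<close> of non-isolated vertices leaves at most \<open>card S choose 2\<close> free edges.\<close>

lemma layer_step:
  fixes w :: "nat \<Rightarrow> real"
  assumes E: "finite E" and j: "j + 2 \<le> card E" and F: "F \<subseteq> layer E j" and A: "A \<subseteq> layer E j"
  defines "k \<equiv> (card E - j) choose 2"
  shows "(\<Sum>V | F \<union> A \<subseteq> V \<and> V \<subseteq> layer E j.
             \<Prod>Z\<in>layer E (j + 2). (2 powr (- w (card (cover V Z)))) powr (1/k))
       \<le> 2 powr (- real (card F)) * (\<Prod>Z\<in>layer E (j + 2).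
             (\<Sum>S | cover A Z \<subseteq> S \<and> S \<subseteq> Z. 2 powr (real (card S choose 2) - w (card S))) powr (1/k))"
proof -
  let ?L = "layer E j" and ?M = "layer E (j + 2)"
  define B where "B = (\<lambda>Z::'a set. {X. X \<subseteq> Z})"
  \<comment> \<open>Setting \<open>G\<close> to 0 on blocks that miss a forced set keeps the sum
    over all \<open>V\<close> within the bound while allowing it to factorise.\<close>
  define G where "G = (\<lambda>Z y. if (F \<union> A) \<inter> B Z \<subseteq> y then 2 powr (- w (card (cover y Z))) else 0)"
  have k: "k > 0" using j by (simp add: k_def zero_less_binomial)
  have deg: "card {Z\<in>?M. X \<in> B Z} = k" if "X \<in> ?L" for X
    using card_layer_supersets[OF E, of X 2] that by (simp add: B_def k_def layer_def)
  have "(\<Sum>V | F \<union> A \<subseteq> V \<and> V \<subseteq> ?L. \<Prod>Z\<in>?M. (2 powr (- w (card (cover V Z)))) powr (1/k))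
      = (\<Sum>V | F \<union> A \<subseteq> V \<and> V \<subseteq> ?L. \<Prod>Z\<in>?M. G Z (V \<inter> B Z) powr (1/k))"
    by (intro sum.cong prod.cong refl arg_cong2[where f="(powr)"])
       (auto simp: G_def B_def cover_restrict)
  also have "\<dots> \<le> (\<Sum>V\<in>Pow ?L. \<Prod>Z\<in>?M. G Z (V \<inter> B Z) powr (1/k))"
    using E by (intro sum_mono2 prod_nonneg) auto
  also have "\<dots> \<le> (\<Prod>Z\<in>?M. (\<Sum>y\<in>Pow (?L \<inter> B Z). G Z y) powr (1/k))"
    using E k deg by (intro finner_inequality) (auto simp: G_def)
  also have "\<dots> \<le> (\<Prod>Z\<in>?M. (2 powr (- real (card (F \<inter> B Z))) *
      (\<Sum>S | cover A Z \<subseteq> S \<and> S \<subseteq> Z. 2 powr (real (card S choose 2) - w (card S)))) powr (1/k))"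
  proof (intro prod_mono conjI powr_mono2)
    fix Z assume Z: "Z \<in> ?M"
    then have fZ: "finite Z" "Z \<subseteq> E" "card Z = j + 2" using E finite_layer_mem by (auto simp: layer_def)
    let ?P = "{X. X \<subseteq> Z \<and> card X + 2 = card Z}"
    have P: "?L \<inter> B Z = ?P" using fZ by (auto simp: layer_def B_def)
    have finP: "finite ?P" using fZ by (auto intro: finite_subset[of _ "Pow Z"])
    have "(\<Sum>y\<in>Pow (?L \<inter> B Z). G Z y)
        = (\<Sum>y | (F \<union> A) \<inter> B Z \<subseteq> y \<and> y \<subseteq> ?P. 2 powr (- w (card (cover y Z))))"
      unfolding P using finP
      by (intro sum.mono_neutral_cong_right) (auto simp: G_def)
    \<comment> \<open>Of \<open>A\<close> only the covered points are remembered. Of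
      \<open>F\<close> the edges themselves are kept, since their number yields the factor
      \<open>2 powr (- card F)\<close>.\<close>
    also have "\<dots> \<le> (\<Sum>y | F \<inter> B Z \<subseteq> y \<and> y \<subseteq> ?P \<and> cover A Z \<subseteq> cover y Z. 2 powr (- w (card (cover y Z))))"
    proof (intro sum_mono2 finite_subset[OF _ finite_Pow_iff[THEN iffD2, OF finP]])
      show "{y. (F \<union> A) \<inter> B Z \<subseteq> y \<and> y \<subseteq> ?P} \<subseteq> {y. F \<inter> B Z \<subseteq> y \<and> y \<subseteq> ?P \<and> cover A Z \<subseteq> cover y Z}"
      proof safe
        fix y a assume y: "(F \<union> A) \<inter> B Z \<subseteq> y" and a: "a \<in> cover A Z"
        have "cover A Z \<subseteq> cover y Z"
          using y cover_mono[of "A \<inter> B Z" y Z] cover_restrict[of A Z] by (auto simp: B_def)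
        then show "a \<in> cover y Z" using a by auto
      qed auto
    qed auto
    also have "\<dots> = (\<Sum>S | cover A Z \<subseteq> S \<and> S \<subseteq> Z.
        \<Sum>y | y \<in> {y. F \<inter> B Z \<subseteq> y \<and> y \<subseteq> ?P \<and> cover A Z \<subseteq> cover y Z} \<and> cover y Z = S. 2 powr (- w (card (cover y Z))))"
      using fZ finP cover_subset[of _ Z]
      by (intro sum.group[symmetric]) (auto intro: finite_subset[of _ "Pow ?P"])
    also have "\<dots> \<le> (\<Sum>S | cover A Z \<subseteq> S \<and> S \<subseteq> Z.
        2 powr (- real (card (F \<inter> B Z))) * 2 powr (real (card S choose 2) - w (card S)))"
    proof (intro sum_mono)
      fix S assume S: "S \<in> {S. cover A Z \<subseteq> S \<and> S \<subseteq> Z}"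
      have eq: "{y. y \<in> {y. F \<inter> B Z \<subseteq> y \<and> y \<subseteq> ?P \<and> cover A Z \<subseteq> cover y Z} \<and> cover y Z = S}
        = {y. F \<inter> B Z \<subseteq> y \<and> y \<subseteq> ?P \<and> cover y Z = S}"
        using S by auto
      have "(\<Sum>y | y \<in> {y. F \<inter> B Z \<subseteq> y \<and> y \<subseteq> ?P \<and> cover A Z \<subseteq> cover y Z} \<and> cover y Z = S.
          2 powr (- w (card (cover y Z))))
          = (\<Sum>y | F \<inter> B Z \<subseteq> y \<and> y \<subseteq> ?P \<and> cover y Z = S. 2 powr (- w (card S)))"
        unfolding eq by (rule sum.cong[OF refl]) (simp only: mem_Collect_eq)
      also have "\<dots> = real (card {y. F \<inter> B Z \<subseteq> y \<and> y \<subseteq> ?P \<and> cover y Z = S}) * 2 powr (- w (card S))"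
        by (rule sum_constant)
      also have "\<dots> \<le> 2 powr (real (card S choose 2) - card (F \<inter> B Z)) * 2 powr (- w (card S))"
      proof (intro mult_right_mono card_cover_fibre[OF fZ(1)])
        show "card X + 2 = card Z" if "X \<in> F \<inter> B Z" for X
          using that F fZ by (auto simp: layer_def)
      qed (auto simp: B_def)
      also have "\<dots> = 2 powr (- real (card (F \<inter> B Z))) * 2 powr (real (card S choose 2) - w (card S))"
        by (simp only: powr_add[symmetric]) (simp add: algebra_simps)
      finally show "(\<Sum>y | y \<in> {y. F \<inter> B Z \<subseteq> y \<and> y \<subseteq> ?P \<and> cover A Z \<subseteq> cover y Z} \<and> cover y Z = S.
          2 powr (- w (card (cover y Z)))) \<le> \<dots>" .
    qed
    finally show "(\<Sum>y\<in>Pow (?L \<inter> B Z). G Z y) \<le> 2 powr (- real (card (F \<inter> B Z))) *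
      (\<Sum>S | cover A Z \<subseteq> S \<and> S \<subseteq> Z. 2 powr (real (card S choose 2) - w (card S)))"
      by (simp add: sum_distrib_left)
  qed (simp_all add: G_def sum_nonneg)
  also have "\<dots> = (\<Prod>Z\<in>?M. (2 powr (- real (card (F \<inter> B Z)))) powr (1/k)) *
      (\<Prod>Z\<in>?M. (\<Sum>S | cover A Z \<subseteq> S \<and> S \<subseteq> Z. 2 powr (real (card S choose 2) - w (card S))) powr (1/k))"
    unfolding prod.distrib[symmetric] by (intro prod.cong refl powr_mult) 
  also have "(\<Prod>Z\<in>?M. (2 powr (- real (card (F \<inter> B Z)))) powr (1/k))
      = 2 powr (- real (\<Sum>Z\<in>?M. card (F \<inter> B Z)) / k)"
    using E by (simp add: powr_powr powr_sum[symmetric] sum_negf sum_divide_distrib)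
  \<comment> \<open>Every set of \<open>F\<close> lies in exactly \<open>k\<close> blocks, which
    cancels the exponent \<open>1/k\<close>.\<close>
  also have "(\<Sum>Z\<in>?M. card (F \<inter> B Z)) = (\<Sum>Z\<in>?M. \<Sum>X\<in>F. if X \<in> B Z then 1 else 0)"
    using F E by (intro sum.cong) (auto simp: sum.If_cases Int_def dest: finite_subset)
  also have "\<dots> = (\<Sum>X\<in>F. card {Z\<in>?M. X \<in> B Z})"
    using E by (subst sum.swap) (simp add: sum.If_cases Int_def)
  also have "\<dots> = card F * k"
    using deg F by (simp add: subset_iff)
  finally show ?thesis using k by simp
qed

section \<open>Up-sets layer by layer\<close>

text \<open>The non-faces of a complex, truncated to the non-empty sets of size at most \<open>h\<close>.\<close>

definition up_families :: "'a set \<Rightarrow> nat \<Rightarrow> 'a set set set" where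
  "up_families E h = {U. U \<subseteq> {S. S \<subseteq> E \<and> S \<noteq> {} \<and> card S \<le> h} \<and>
     (\<forall>S\<in>U. \<forall>T. S \<subseteq> T \<and> T \<subseteq> E \<and> card T \<le> h \<longrightarrow> T \<in> U)}"

lemma finite_up_families [simp]: "finite E \<Longrightarrow> finite (up_families E h)"
  by (rule finite_subset[of _ "Pow (Pow E)"]) (auto simp: up_families_def)

lemma up_families_0 [simp]:
  assumes "finite E"
  shows "up_families E 0 = {{}}"
proof -
  have *: "{S. S \<subseteq> E \<and> S \<noteq> {} \<and> card S \<le> 0} = {}"
    using assms by (auto dest: finite_subset)
  show ?thesis unfolding up_families_def * by (simp cong: conj_cong)
qed

lemma up_familiesI:
  assumes "\<And>S. S \<in> U \<Longrightarrow> S \<subseteq> E \<and> S \<noteq> {} \<and> card S \<le> h"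
    and "\<And>S T. S \<in> U \<Longrightarrow> S \<subseteq> T \<Longrightarrow> T \<subseteq> E \<Longrightarrow> card T \<le> h \<Longrightarrow> T \<in> U"
  shows "U \<in> up_families E h"
  using assms unfolding up_families_def by blast

lemma up_families_Suc_restrict:
  assumes "finite E" "U \<in> up_families E (Suc j)"
  defines "U' \<equiv> U - layer E (Suc j)" and "V \<equiv> U \<inter> layer E (Suc j)"
  shows "U' \<in> up_families E j" "upper_shadow E (U' \<inter> layer E j) \<subseteq> V" "V \<subseteq> layer E (Suc j)"
proof -
  have U: "S \<subseteq> E" "S \<noteq> {}" "card S \<le> Suc j" if "S \<in> U" for S
    using assms(2) that by (auto simp: up_families_def)
  have up: "T \<in> U" if "S \<in> U" "S \<subseteq> T" "T \<subseteq> E" "card T \<le> Suc j" for S T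
    using assms(2) that unfolding up_families_def by blast
  show "U' \<in> up_families E j"
  proof (rule up_familiesI)
    fix S assume "S \<in> U'"
    then show "S \<subseteq> E \<and> S \<noteq> {} \<and> card S \<le> j"
      using U[of S] by (auto simp: U'_def layer_def)
  next
    fix S T assume "S \<in> U'" "S \<subseteq> T" "T \<subseteq> E" "card T \<le> j"
    then show "T \<in> U'" using up[of S T] by (auto simp: U'_def layer_def)
  qed
  show "upper_shadow E (U' \<inter> layer E j) \<subseteq> V"
    by (auto simp: upper_shadow_def U'_def V_def layer_def intro: up)
  show "V \<subseteq> layer E (Suc j)" by (simp add: V_def)
qed

text \<open>Closure upwards is a condition on consecutive layers only: between a member of
  \<open>U'\<close> and a superset of size \<open>Suc j\<close> there is a set of size
  \<open>j\<close>, so the superset lies in the shadow of layer \<open>j\<close>.\<close>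

lemma up_families_Suc_extend:
  assumes "finite E" "U' \<in> up_families E j"
    and V: "upper_shadow E (U' \<inter> layer E j) \<subseteq> V" "V \<subseteq> layer E (Suc j)"
  shows "U' \<union> V \<in> up_families E (Suc j)"
proof -
  have U: "S \<subseteq> E" "S \<noteq> {}" "card S \<le> j" if "S \<in> U'" for S
    using assms(2) that by (auto simp: up_families_def)
  have up: "T \<in> U'" if "S \<in> U'" "S \<subseteq> T" "T \<subseteq> E" "card T \<le> j" for S T
    using assms(2) that unfolding up_families_def by blast
  show ?thesis
  proof (rule up_familiesI)
    fix S assume "S \<in> U' \<union> V"
    then show "S \<subseteq> E \<and> S \<noteq> {} \<and> card S \<le> Suc j"
      using U[of S] V(2) by (auto simp: layer_def)
  next
    fix S T assume S: "S \<in> U' \<union> V" and T: "S \<subseteq> T" "T \<subseteq> E" "card T \<le> Suc j"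
    have fT: "finite T" using T assms(1) finite_subset by auto
    show "T \<in> U' \<union> V"
    proof (cases "S \<in> U'")
      case False
      then have "S \<in> V" "card S = Suc j" using S V(2) by (auto simp: layer_def)
      then have "S = T" using T fT by (metis card_seteq)
      then show ?thesis using \<open>S \<in> V\<close> by simp
    next
      case True
      show ?thesis
      proof (cases "card T \<le> j")
        case True
        then show ?thesis using up[of S T] \<open>S \<in> U'\<close> T by auto
      next
        case False
        then have cT: "card T = Suc j" using T by auto
        then obtain T' where T': "S \<subseteq> T'" "T' \<subseteq> T" "card T' = j"
          using exists_subset_between[of S j T] U(3)[OF True] T fT by auto
        then have "T' \<in> U' \<inter> layer E j"
          using up[OF True T'(1)] T by (auto simp: layer_def)
        then have "T \<in> upper_shadow E (U' \<inter> layer E j)"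
          unfolding upper_shadow_def using T T' cT by auto
        then show ?thesis using V(1) by auto
      qed
    qed
  qed
qed

lemma up_families_disjoint_layer:
  assumes "U' \<in> up_families E j"
  shows "U' \<inter> layer E (Suc j) = {}"
  using assms by (auto simp: up_families_def layer_def)

lemma sum_up_families_Suc:
  fixes g :: "'a set set \<Rightarrow> real"
  assumes "finite E"
  shows "(\<Sum>U\<in>up_families E (Suc j). g U) = (\<Sum>U'\<in>up_families E j.
     \<Sum>V | upper_shadow E (U' \<inter> layer E j) \<subseteq> V \<and> V \<subseteq> layer E (Suc j). g (U' \<union> V))"
proof -
  let ?L = "layer E (Suc j)"
  let ?S = "SIGMA U':up_families E j. {V. upper_shadow E (U' \<inter> layer E j) \<subseteq> V \<and> V \<subseteq> ?L}"
  have fin: "finite {V. upper_shadow E (U' \<inter> layer E j) \<subseteq> V \<and> V \<subseteq> ?L}" for U'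
    by (rule finite_subset[of _ "Pow ?L"]) (use assms in auto)
  have "(\<Sum>U\<in>up_families E (Suc j). g U) = (\<Sum>(U', V)\<in>?S. g (U' \<union> V))"
  proof (rule sum.reindex_bij_witness[where i = "\<lambda>(U', V). U' \<union> V" and j = "\<lambda>U. (U - ?L, U \<inter> ?L)"])
    fix U assume "U \<in> up_families E (Suc j)"
    from up_families_Suc_restrict[OF assms this]
    show "(U - ?L, U \<inter> ?L) \<in> ?S" by simp
    show "(case (U - ?L, U \<inter> ?L) of (U', V) \<Rightarrow> U' \<union> V) = U" by auto
    then show "(case (U - ?L, U \<inter> ?L) of (U', V) \<Rightarrow> g (U' \<union> V)) = g U" by simp
  next
    fix p assume "p \<in> ?S"
    then obtain U' V where p: "p = (U', V)" and U': "U' \<in> up_families E j"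
      and V: "upper_shadow E (U' \<inter> layer E j) \<subseteq> V" "V \<subseteq> ?L" by auto
    from up_families_Suc_extend[OF assms U' V]
    show "(case p of (U', V) \<Rightarrow> U' \<union> V) \<in> up_families E (Suc j)" by (simp add: p)
    show "((case p of (U', V) \<Rightarrow> U' \<union> V) - ?L, (case p of (U', V) \<Rightarrow> U' \<union> V) \<inter> ?L) = p"
      using up_families_disjoint_layer[OF U'] V(2) by (auto simp: p)
  qed
  also have "\<dots> = (\<Sum>U'\<in>up_families E j.
     \<Sum>V | upper_shadow E (U' \<inter> layer E j) \<subseteq> V \<and> V \<subseteq> ?L. g (U' \<union> V))"
    using assms fin by (intro sum.Sigma[symmetric]) auto
  finally show ?thesis .
qed

section \<open>Binomial estimates and weighted counts of covers\<close>

lemma one_plus_third_le_powr: "1 + real u / 3 \<le> 2 powr ((real u + 1) / 2)"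
proof -
  have "(4/3::real) \<le> sqrt 2" by (rule real_le_rsqrt) (simp add: power2_eq_square)
  have "1 + real u / 3 \<le> 1 + real (Suc u) * (1/3)" by simp
  also have "\<dots> \<le> (1 + 1/3) ^ Suc u" by (rule Bernoulli_inequality) simp
  also have "\<dots> \<le> sqrt 2 ^ Suc u" using \<open>4/3 \<le> sqrt 2\<close> by (intro power_mono) auto
  also have "\<dots> = (2 powr (1/2)) powr real (Suc u)"
    by (subst powr_realpow) (auto simp: powr_half_sqrt)
  also have "\<dots> = 2 powr ((real u + 1) / 2)" by (simp add: powr_powr add.commute)
  finally show ?thesis .
qed

lemma real_choose_two: "real (n choose 2) = real n * (real n - 1) / 2"
proof (cases n)
  case (Suc m)
  have "2 * (n choose 2) = n * m" using Suc by (simp add: choose_two)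
  then have "2 * real (n choose 2) = real n * real m"
    by (metis of_nat_mult of_nat_numeral)
  then show ?thesis using Suc by simp
qed simp

text \<open>Raising the lower index from \<open>s + 2\<close> to \<open>s + 3\<close> multiplies by
  \<open>1 + u / (s + 3)\<close>, at most \<open>1 + u / 3\<close>. Starting at 2 keeps the bound
  polynomial for lower index 2, which is what the forced blocks need later.\<close>

lemma binomial_le_powr:
  "real ((u + (s + 2)) choose (s + 2)) \<le> (real u + 2)\<^sup>2 * 2 powr (real s * (real u + 1) / 2)"
proof (induction s)
  case 0
  have "(real u + 2) * (real u + 1) / 2 \<le> (real u + 2)\<^sup>2"
    by (simp add: power2_eq_square field_simps)
  then show ?case unfolding add_0 real_choose_two by (simp add: algebra_simps)
next
  case (Suc s)
  define a b where "a = real (Suc (u + (s + 2)) choose Suc (s + 2))" and "b = real ((u + (s + 2)) choose (s + 2))"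
  have "real (Suc (s + 2)) * a = real (Suc (u + (s + 2))) * b"
    unfolding a_def b_def of_nat_mult[symmetric] of_nat_eq_iff by (rule Suc_times_binomial)
  then have "(real s + 3) * a = (real s + 3 + real u) * b"
    by (simp add: algebra_simps)
  then have "a = (1 + real u / (real s + 3)) * b"
    by (simp add: field_simps)
  also have "\<dots> \<le> 2 powr ((real u + 1) / 2) * ((real u + 2)\<^sup>2 * 2 powr (real s * (real u + 1) / 2))"
    unfolding b_def
  proof (intro mult_mono Suc.IH)
    have "real u / (real s + 3) \<le> real u / 3" by (rule divide_left_mono) auto
    then show "1 + real u / (real s + 3) \<le> 2 powr ((real u + 1) / 2)"
      using one_plus_third_le_powr[of u] by linarith
  qed auto
  also have "\<dots> = (real u + 2)\<^sup>2 * 2 powr (real (Suc s) * (real u + 1) / 2)"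
  proof -
    have "real (Suc s) * (real u + 1) / 2 = (real u + 1) / 2 + real s * (real u + 1) / 2"
      by (simp add: field_simps)
    then show ?thesis by (simp only: powr_add) simp
  qed
  finally show ?case unfolding a_def by (simp only: add_Suc add_Suc_right)
qed

lemma binomial_le_powr':
  assumes "s \<le> t"
  shows "real (t choose s) \<le> (real t + 1)\<^sup>2 * 2 powr (real (s - 2) * (real t + 1 - real s) / 2)"
proof (cases "s \<ge> 2")
  case True
  then obtain s' where s': "s = s' + 2" by (metis le_add_diff_inverse2)
  obtain u where u: "t = u + s" using assms by (metis le_add_diff_inverse2)
  have "real (t choose s) \<le> (real u + 2)\<^sup>2 * 2 powr (real s' * (real u + 1) / 2)"
    unfolding u s' by (rule binomial_le_powr)
  also have "\<dots> \<le> (real t + 1)\<^sup>2 * 2 powr (real s' * (real u + 1) / 2)"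
    using u s' by (intro mult_right_mono power_mono) auto
  finally show ?thesis using u s' by (simp add: algebra_simps)
next
  case False
  then have "s = 0 \<or> s = 1" by linarith
  then have "real (t choose s) \<le> real t + 1" by auto
  also have "\<dots> \<le> (real t + 1)\<^sup>2" by (simp add: power2_eq_square)
  finally show ?thesis using False by simp
qed

lemma sum_subsets_by_card:
  fixes f :: "nat \<Rightarrow> real"
  assumes "finite Z"
  shows "(\<Sum>S\<in>Pow Z. f (card S)) = (\<Sum>s\<le>card Z. real (card Z choose s) * f s)"
proof -
  have "(\<Sum>S\<in>Pow Z. f (card S)) = (\<Sum>s\<le>card Z. \<Sum>S | S \<in> Pow Z \<and> card S = s. f (card S))"
    using assms by (intro sum.group[symmetric]) (auto intro: card_mono)
  also have "\<dots> = (\<Sum>s\<le>card Z. \<Sum>S | S \<in> Pow Z \<and> card S = s. f s)"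
    by (intro sum.cong) auto
  also have "\<dots> = (\<Sum>s\<le>card Z. real (card Z choose s) * f s)"
    using n_subsets[OF assms] by simp
  finally show ?thesis .
qed

text \<open>For a set of size s the exponent is at most - s (t + 1 - s) / 2, which outweighs the
  growth of \<open>t choose s\<close>. In the applications \<open>t = j + 2\<close> and
  \<open>m = card E - j\<close>, so \<open>real t \<le> m\<close> says that layer \<open>j\<close>
  is below the middle.\<close>

lemma cover_weight_sum_le:
  assumes "finite Z" "card Z = t" "real t \<le> m"
  shows "(\<Sum>S | S \<subseteq> Z. 2 powr (real (card S choose 2) - real (card S) * m / 2)) \<le> (real t + 1) ^ 3"
proof -
  have "(\<Sum>S | S \<subseteq> Z. 2 powr (real (card S choose 2) - real (card S) * m / 2))
      = (\<Sum>s\<le>t. real (t choose s) * 2 powr (real (s choose 2) - real s * m / 2))"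
    using sum_subsets_by_card[OF assms(1), of "\<lambda>s. 2 powr (real (s choose 2) - real s * m / 2)"] assms(2)
    by (simp add: Pow_def)
  also have "\<dots> \<le> (\<Sum>s\<le>t. (real t + 1)\<^sup>2)"
  proof (intro sum_mono)
    fix s assume "s \<in> {..t}"
    then have s: "s \<le> t" by simp
    have "real (s - 2) * (real t + 1 - real s) \<le> real s * (real t + 1 - real s)"
      using s by (intro mult_right_mono) auto
    moreover have "real s * real t \<le> real s * m"
      using assms(3) by (intro mult_left_mono) auto
    ultimately have e: "real (s - 2) * (real t + 1 - real s) / 2 + (real (s choose 2) - real s * m / 2) \<le> 0"
      unfolding real_choose_two by (simp add: field_simps)
    have "real (t choose s) * 2 powr (real (s choose 2) - real s * m / 2)
      \<le> (real t + 1)\<^sup>2 * 2 powr (real (s - 2) * (real t + 1 - real s) / 2) * 2 powr (real (s choose 2) - real s * m / 2)"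
      by (intro mult_right_mono binomial_le_powr' s) auto
    also have "\<dots> = (real t + 1)\<^sup>2 * 2 powr (real (s - 2) * (real t + 1 - real s) / 2 + (real (s choose 2) - real s * m / 2))"
      by (simp only: powr_add mult.assoc)
    also have "\<dots> \<le> (real t + 1)\<^sup>2 * 1"
      using e powr_mono[of _ 0 "2::real"] by (intro mult_left_mono) auto
    finally show "real (t choose s) * 2 powr (real (s choose 2) - real s * m / 2) \<le> (real t + 1)\<^sup>2" by simp
  qed
  also have "\<dots> = (real t + 1) ^ 3" by (simp add: power2_eq_square power3_eq_cube)
  finally show ?thesis .
qed

text \<open>Forcing two covered points excludes the empty cover, which alone contributes 1. For s at
  least 2 and \<open>m = t + 2\<close>, the binomial growth and the weight combine to the exponent
  \<open>- (t + 1)\<close> for every s.\<close>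

lemma cover_weight_sum_forced_le:
  assumes "finite Z" "card Z = t" "m = real t + 2" "card C \<ge> 2"
  shows "(\<Sum>S | C \<subseteq> S \<and> S \<subseteq> Z. 2 powr (real (card S choose 2) - real (card S) * m / 2))
    \<le> (real t + 1) ^ 3 * 2 powr (- (real t + 1))"
proof -
  let ?f = "\<lambda>s. if s < 2 then 0 else 2 powr (real (s choose 2) - real s * m / 2)"
  have "(\<Sum>S | C \<subseteq> S \<and> S \<subseteq> Z. 2 powr (real (card S choose 2) - real (card S) * m / 2))
      \<le> (\<Sum>S\<in>Pow Z. ?f (card S))"
  proof -
    have "card S \<ge> 2" if "C \<subseteq> S" "S \<subseteq> Z" for S
      using that assms by (meson card_mono finite_subset order_trans)
    then have "(\<Sum>S | C \<subseteq> S \<and> S \<subseteq> Z. 2 powr (real (card S choose 2) - real (card S) * m / 2))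
      = (\<Sum>S | C \<subseteq> S \<and> S \<subseteq> Z. ?f (card S))"
      by (intro sum.cong) (auto simp: not_less[symmetric])
    also have "\<dots> \<le> (\<Sum>S\<in>Pow Z. ?f (card S))"
      using assms(1) by (intro sum_mono2) auto
    finally show ?thesis .
  qed
  also have "\<dots> = (\<Sum>s\<le>t. real (t choose s) * ?f s)"
    using sum_subsets_by_card[OF assms(1), of ?f] assms(2) by simp
  also have "\<dots> \<le> (\<Sum>s\<le>t. (real t + 1)\<^sup>2 * 2 powr (- (real t + 1)))"
  proof (intro sum_mono)
    fix s assume "s \<in> {..t}"
    then have s: "s \<le> t" by simp
    show "real (t choose s) * ?f s \<le> (real t + 1)\<^sup>2 * 2 powr (- (real t + 1))"
    proof (cases "s < 2")
      case False
      then have e: "real (s - 2) * (real t + 1 - real s) / 2 + (real (s choose 2) - real s * m / 2) = - (real t + 1)"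
        unfolding real_choose_two assms(3) by (simp add: of_nat_diff field_simps)
      have "real (t choose s) * 2 powr (real (s choose 2) - real s * m / 2)
        \<le> (real t + 1)\<^sup>2 * 2 powr (real (s - 2) * (real t + 1 - real s) / 2) * 2 powr (real (s choose 2) - real s * m / 2)"
        by (intro mult_right_mono binomial_le_powr' s) auto
      also have "\<dots> = (real t + 1)\<^sup>2 * 2 powr (- (real t + 1))"
        by (simp only: powr_add[symmetric] mult.assoc e)
      finally show ?thesis using False by simp
    qed simp
  qed
  also have "\<dots> = (real t + 1) ^ 3 * 2 powr (- (real t + 1))"
    by (simp add: power2_eq_square power3_eq_cube)
  finally show ?thesis .
qed

text \<open>By \<open>sum_card_cover\<close> the block weights add up to
  \<open>k * card (upper_shadow E V)\<close>, so a global weight becomes a product over blocks to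
  which \<open>layer_step\<close> applies.\<close>

lemma upper_shadow_weight:
  assumes "finite E" "V \<subseteq> layer E j" "j + 2 \<le> card E"
  defines "k \<equiv> (card E - j) choose 2"
  shows "(\<Prod>Z\<in>layer E (j + 2). (2 powr (- (real (card (cover V Z)) * (real (card E) - j) / 2))) powr (1/k))
    = 2 powr (- real (card (upper_shadow E V)))"
proof -
  have k: "real k = (real (card E) - j) * (real (card E) - j - 1) / 2"
    unfolding k_def real_choose_two using assms(3) by (simp add: of_nat_diff)
  have k0: "real k > 0" unfolding k using assms(3) by (intro divide_pos_pos mult_pos_pos) auto
  have "(\<Prod>Z\<in>layer E (j + 2). (2 powr (- (real (card (cover V Z)) * (real (card E) - j) / 2))) powr (1/k))
    = 2 powr (\<Sum>Z\<in>layer E (j + 2). - (real (card (cover V Z)) * (real (card E) - j) / 2) * (1/k))"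
    by (simp add: powr_powr powr_sum)
  also have "(\<Sum>Z\<in>layer E (j + 2). - (real (card (cover V Z)) * (real (card E) - j) / 2) * (1/k))
    = - (real (\<Sum>Z\<in>layer E (j + 2). card (cover V Z)) * (real (card E) - j) / (2 * k))"
    by (simp add: sum_negf sum_divide_distrib sum_distrib_right)
  also have "\<dots> = - (real (card (upper_shadow E V)) * ((real (card E) - j) * (real (card E) - j - 1) / 2) / k)"
  proof -
    have "real (card E - Suc j) = real (card E) - j - 1" using assms(3) by (simp add: of_nat_diff)
    then show ?thesis unfolding sum_card_cover[OF assms(1,2)] of_nat_mult by (simp add: field_simps)
  qed
  also have "\<dots> = - real (card (upper_shadow E V))"
    unfolding k[symmetric] using k0 by simp
  finally show ?thesis .
qed

section \<open>The Johnson graph and covering by stars\<close>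

lemma card_Diff_swap:
  assumes "finite Y" "finite Y'" "card Y = card Y'"
  shows "card (Y - Y') = card (Y' - Y)"
proof -
  have "card Y = card (Y \<inter> Y') + card (Y - Y')" "card Y' = card (Y' \<inter> Y) + card (Y' - Y)"
    using assms by (simp_all only: card_Int_Diff[symmetric])
  then show ?thesis using assms(3) by (simp add: Int_commute)
qed

lemma johnson_adjacent:
  assumes "finite Y" "finite Y'" "card Y = card Y'" "card (Y - Y') = 1"
  shows "\<exists>a b. Y - Y' = {a} \<and> Y' - Y = {b}"
proof -
  have *: "card (Y' - Y) = 1" using assms(4) card_Diff_swap[OF assms(1-3)] by simp
  obtain a where "Y - Y' = {a}" using assms(4) by (rule card_1_singletonE)
  moreover obtain b where "Y' - Y = {b}" using * by (rule card_1_singletonE)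
  ultimately show ?thesis by blast
qed

text \<open>Swapping \<open>a\<close> for \<open>b\<close> increases the distance from
  \<open>Y\<close> only if a point of \<open>Y\<close> is given up for a foreign one.\<close>

lemma johnson_step_mem:
  assumes fin: "finite Y" "finite Y'" "finite Y''"
    and "Y' - Y'' = {a}" "Y'' - Y' = {b}" and c: "card (Y - Y') = t" "card (Y - Y'') = Suc t"
  shows "a \<in> Y \<and> b \<notin> Y"
proof -
  have Y'': "Y'' = insert b (Y' - {a})" "a \<in> Y'" "b \<notin> Y'" using assms(4,5) by auto
  show ?thesis
  proof (rule ccontr)
    assume "\<not> (a \<in> Y \<and> b \<notin> Y)"
    then consider "a \<notin> Y" | "a \<in> Y" "b \<in> Y" by auto
    then have "card (Y - Y'') \<le> card (Y - Y')"
    proof cases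
      case 1
      then have "Y - Y'' \<subseteq> Y - Y'" using Y'' by auto
      then show ?thesis using fin by (intro card_mono) auto
    next
      case 2
      then have eq: "Y - Y'' = insert a (Y - Y' - {b})" using Y'' by auto
      have "b \<in> Y - Y'" using 2 Y'' by auto
      then have "card (Y - Y' - {b}) = card (Y - Y') - 1" "card (Y - Y') > 0"
        using fin by (auto simp: card_gt_0_iff)
      then show ?thesis unfolding eq using fin by (simp add: card_insert_if)
    qed
    then show False using c by simp
  qed
qed

context
  fixes E :: "'a set" and h :: nat and G :: "'a set set"
  assumes fE: "finite E" and cE: "card E = 2 * h" and G: "G \<subseteq> layer E h"
begin

abbreviation (input) "pairs d \<equiv> johnson_pairs E h d G"

lemma layer_facts: "Y \<in> layer E h \<Longrightarrow> finite Y \<and> Y \<subseteq> E \<and> card Y = h"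
  using fE by (auto simp: layer_def intro: finite_subset)

lemma finite_johnson_pairs: "finite (pairs d)"
  by (rule finite_subset[of _ "layer E h \<times> layer E h"]) (use G fE in \<open>auto simp: johnson_pairs_def\<close>)

text \<open>One swap from \<open>Y''\<close> towards \<open>Y\<close> exchanges a point of
  \<open>Y'' - Y\<close> for a point of \<open>Y - Y''\<close>.\<close>

lemma card_between:
  assumes "Y \<in> layer E h" "Y'' \<in> layer E h" "card (Y - Y'') = Suc t"
  shows "(Suc t)\<^sup>2 \<le> card {Y'\<in>layer E h. card (Y - Y') = t \<and> card (Y' - Y'') = 1}"
proof -
  note f = layer_facts[OF assms(1)] layer_facts[OF assms(2)]
  let ?f = "\<lambda>(y, z). insert z (Y'' - {y})"
  have "inj_on ?f ((Y'' - Y) \<times> (Y - Y''))"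
  proof (rule inj_onI, clarsimp)
    fix y z y' z'
    assume *: "y \<in> Y''" "y \<notin> Y" "z \<in> Y" "z \<notin> Y''" "y' \<in> Y''" "y' \<notin> Y" "z' \<in> Y" "z' \<notin> Y''"
      and eq: "insert z (Y'' - {y}) = insert z' (Y'' - {y'})"
    have "z = z'" using * eq by (metis Diff_iff insert_iff)
    moreover have "y = y'" using * eq by (metis Diff_iff insert_iff singletonD)
    ultimately show "y = y' \<and> z = z'" by simp
  qed
  then have "card (?f ` ((Y'' - Y) \<times> (Y - Y''))) = card (Y'' - Y) * card (Y - Y'')"
    by (simp add: card_image card_cartesian_product)
  also have "\<dots> = (Suc t)\<^sup>2"
    using assms(3) card_Diff_swap[of Y Y''] f by (simp add: power2_eq_square)
  finally have "card (?f ` ((Y'' - Y) \<times> (Y - Y''))) = (Suc t)\<^sup>2" .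
  moreover have "?f ` ((Y'' - Y) \<times> (Y - Y'')) \<subseteq> {Y'\<in>layer E h. card (Y - Y') = t \<and> card (Y' - Y'') = 1}"
  proof (rule image_subsetI)
    fix p assume "p \<in> (Y'' - Y) \<times> (Y - Y'')"
    then obtain y z where p: "p = (y, z)" and *: "y \<in> Y''" "y \<notin> Y" "z \<in> Y" "z \<notin> Y''" by auto
    have "Y - insert z (Y'' - {y}) = (Y - Y'') - {z}" using * by auto
    then have 1: "card (Y - insert z (Y'' - {y})) = t" using assms(3) * f by simp
    have "insert z (Y'' - {y}) - Y'' = {z}" using * by auto
    then have 2: "card (insert z (Y'' - {y}) - Y'') = Suc 0" by simp
    have "card Y'' > 0" using * f by (auto simp: card_gt_0_iff)
    then have "card (insert z (Y'' - {y})) = h" using * f by simp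
    then have "insert z (Y'' - {y}) \<in> layer E h" using * f by (auto simp: layer_def)
    then show "?f p \<in> {Y'\<in>layer E h. card (Y - Y') = t \<and> card (Y' - Y'') = 1}"
      using 1 2 p by simp
  qed
  ultimately show ?thesis
    using fE card_mono[of "{Y'\<in>layer E h. card (Y - Y') = t \<and> card (Y' - Y'') = 1}" "?f ` ((Y'' - Y) \<times> (Y - Y''))"]
    by simp
qed

lemma card_after:
  assumes "Y \<in> layer E h" "Y' \<in> layer E h" "card (Y - Y') = t"
  shows "card {Y''\<in>layer E h. card (Y' - Y'') = 1 \<and> card (Y - Y'') = Suc t} \<le> (h - t)\<^sup>2"
proof -
  note f = layer_facts[OF assms(1)] layer_facts[OF assms(2)]
  let ?f = "\<lambda>(a, b). insert b (Y' - {a})"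
  have cI: "card (Y \<inter> Y') = h - t" using card_Int_Diff[of Y Y'] f assms(3) by simp
  have "card (Y \<union> Y') + card (Y \<inter> Y') = h + h" using card_Un_Int[of Y Y'] f by simp
  moreover have "t \<le> h" using card_mono[of Y "Y - Y'"] f assms(3) by auto
  ultimately have "card (Y \<union> Y') = h + t" using cI by simp
  then have cU: "card (E - (Y \<union> Y')) = h - t"
    using f fE cE by (subst card_Diff_subset) auto
  have "{Y''\<in>layer E h. card (Y' - Y'') = 1 \<and> card (Y - Y'') = Suc t}
    \<subseteq> ?f ` ((Y \<inter> Y') \<times> (E - (Y \<union> Y')))"
  proof clarify
    fix Y'' assume Y'': "Y'' \<in> layer E h" "card (Y' - Y'') = 1" "card (Y - Y'') = Suc t"
    note f'' = layer_facts[OF Y''(1)]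
    have "\<exists>a b. Y' - Y'' = {a} \<and> Y'' - Y' = {b}"
      using f f'' Y''(2) by (intro johnson_adjacent) simp_all
    then obtain a b where ab: "Y' - Y'' = {a}" "Y'' - Y' = {b}" by (elim exE conjE)
    have "a \<in> Y \<and> b \<notin> Y"
      by (rule johnson_step_mem[OF _ _ _ ab assms(3) Y''(3)]) (use f f'' in simp_all)
    moreover have "a \<in> Y'" "b \<notin> Y'" "b \<in> E" using ab f'' by blast+
    ultimately have "(a, b) \<in> (Y \<inter> Y') \<times> (E - (Y \<union> Y'))" by simp
    moreover have "Y'' = ?f (a, b)" using ab by auto
    ultimately show "Y'' \<in> ?f ` ((Y \<inter> Y') \<times> (E - (Y \<union> Y')))"
      by (rule rev_image_eqI)
  qed
  then have "card {Y''\<in>layer E h. card (Y' - Y'') = 1 \<and> card (Y - Y'') = Suc t}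
    \<le> card ((Y \<inter> Y') \<times> (E - (Y \<union> Y')))"
    using f fE by (intro surj_card_le) auto
  then show ?thesis by (simp add: card_cartesian_product cI cU power2_eq_square)
qed

text \<open>Such a \<open>Y\<close> contains \<open>a\<close> and avoids \<open>b\<close>, so it is
  determined by the \<open>t\<close> points of \<open>Y' - {a}\<close> that it lacks and the
  \<open>t\<close> points other than \<open>b\<close> that it has outside \<open>Y'\<close>.\<close>

lemma card_before:
  assumes "Y' \<in> layer E h" "Y'' \<in> layer E h" "card (Y' - Y'') = 1"
  shows "card {Y\<in>layer E h. card (Y - Y') = t \<and> card (Y - Y'') = Suc t} \<le> ((h - 1) choose t)\<^sup>2"
proof -
  note f = layer_facts[OF assms(1)] layer_facts[OF assms(2)]
  have "\<exists>a b. Y' - Y'' = {a} \<and> Y'' - Y' = {b}"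
    using f assms(3) by (intro johnson_adjacent) simp_all
  then obtain a b where ab: "Y' - Y'' = {a}" "Y'' - Y' = {b}" by (elim exE conjE)
  have ab': "a \<in> Y'" "b \<notin> Y'" "b \<in> E" using ab f by blast+
  let ?S = "{Y\<in>layer E h. card (Y - Y') = t \<and> card (Y - Y'') = Suc t}"
  let ?T = "layer (Y' - {a}) t \<times> layer (E - Y' - {b}) t"
  have "inj_on (\<lambda>Y. (Y' - Y, Y - Y')) ?S"
    by (rule inj_on_inverseI[where g = "\<lambda>(p, q). (Y' - p) \<union> q"]) auto
  moreover have "(\<lambda>Y. (Y' - Y, Y - Y')) ` ?S \<subseteq> ?T"
  proof (rule image_subsetI)
    fix Y assume "Y \<in> ?S"
    then have Y: "Y \<in> layer E h" "card (Y - Y') = t" "card (Y - Y'') = Suc t" by auto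
    note fY = layer_facts[OF Y(1)]
    have "a \<in> Y \<and> b \<notin> Y"
      by (rule johnson_step_mem[OF _ _ _ ab Y(2,3)]) (use f fY in simp_all)
    moreover have "card (Y' - Y) = t" using card_Diff_swap[of Y Y'] f fY Y by simp
    ultimately show "(Y' - Y, Y - Y') \<in> ?T"
      using Y fY by (auto simp: layer_def)
  qed
  ultimately have "card ?S \<le> card ?T" using f fE by (intro card_inj_on_le) auto
  also have "card ?T = ((h - 1) choose t)\<^sup>2"
  proof -
    have "card (E - Y') = h" using f fE cE by (simp add: card_Diff_subset)
    then show ?thesis using f fE ab' by (simp add: card_cartesian_product power2_eq_square)
  qed
  finally show ?thesis .
qed

text \<open>Insert the last vertex Y' before Y'' on a geodesic from Y. If Y' is outside
  \<open>G\<close>, then (Y, Y') is a pair at distance \<open>t\<close>, continued in at most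
  \<open>(h - t)\<^sup>2\<close> ways; if it is inside, (Y', Y'') is a boundary edge, preceded by at
  most \<open>((h - 1) choose t)\<^sup>2\<close> sets Y.\<close>

lemma johnson_pairs_Suc_le:
  "card (pairs (Suc t)) * (Suc t)\<^sup>2 \<le> card (pairs t) * (h - t)\<^sup>2 + card (pairs 1) * ((h - 1) choose t)\<^sup>2"
proof -
  let ?L = "layer E h"
  let ?M = "\<lambda>(Y, Y''). {Y'\<in>?L. card (Y - Y') = t \<and> card (Y' - Y'') = 1}"
  let ?A = "\<lambda>(Y, Y'). {Y''\<in>?L. card (Y' - Y'') = 1 \<and> card (Y - Y'') = Suc t}"
  let ?B = "\<lambda>(Y', Y''). {Y\<in>?L. card (Y - Y') = t \<and> card (Y - Y'') = Suc t}"
  have fin: "finite {Y\<in>?L. P Y}" for P using fE by simp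
  have finA: "finite (?A p)" and finB: "finite (?B p)" for p
    using fin by (cases p; simp)+
  have "card (pairs (Suc t)) * (Suc t)\<^sup>2 = (\<Sum>p\<in>pairs (Suc t). (Suc t)\<^sup>2)" by simp
  also have "\<dots> \<le> (\<Sum>p\<in>pairs (Suc t). card (?M p))"
    using G by (intro sum_mono) (auto simp: johnson_pairs_def intro!: card_between[unfolded One_nat_def])
  also have "\<dots> = card (SIGMA p:pairs (Suc t). ?M p)"
    using finite_johnson_pairs fin by (subst card_SigmaI) auto
  also have "\<dots> \<le> card ((\<lambda>((Y, Y'), Y''). ((Y, Y''), Y')) ` (SIGMA p:pairs t. ?A p)
      \<union> (\<lambda>((Y', Y''), Y). ((Y, Y''), Y')) ` (SIGMA p:pairs 1. ?B p))"
  proof (rule card_mono)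
    show "finite ((\<lambda>((Y, Y'), Y''). ((Y, Y''), Y')) ` (SIGMA p:pairs t. ?A p)
      \<union> (\<lambda>((Y', Y''), Y). ((Y, Y''), Y')) ` (SIGMA p:pairs 1. ?B p))"
      using finite_johnson_pairs finA finB by (intro finite_UnI finite_imageI finite_SigmaI)
    show "(SIGMA p:pairs (Suc t). ?M p) \<subseteq> (\<lambda>((Y, Y'), Y''). ((Y, Y''), Y')) ` (SIGMA p:pairs t. ?A p)
      \<union> (\<lambda>((Y', Y''), Y). ((Y, Y''), Y')) ` (SIGMA p:pairs 1. ?B p)"
    proof (rule subsetI)
      fix x assume "x \<in> (SIGMA p:pairs (Suc t). ?M p)"
      then obtain Y Y'' Y' where x: "x = ((Y, Y''), Y')" and p: "(Y, Y'') \<in> pairs (Suc t)"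
        and Y': "Y' \<in> ?L" "card (Y - Y') = t" "card (Y' - Y'') = 1" by auto
      show "x \<in> (\<lambda>((Y, Y'), Y''). ((Y, Y''), Y')) ` (SIGMA p:pairs t. ?A p)
        \<union> (\<lambda>((Y', Y''), Y). ((Y, Y''), Y')) ` (SIGMA p:pairs 1. ?B p)"
      proof (cases "Y' \<in> G")
        case True
        then have "((Y', Y''), Y) \<in> (SIGMA p:pairs 1. ?B p)"
          using p Y' G by (auto simp: johnson_pairs_def)
        then have "x \<in> (\<lambda>((Y', Y''), Y). ((Y, Y''), Y')) ` (SIGMA p:pairs 1. ?B p)"
          by (rule rev_image_eqI) (simp add: x)
        then show ?thesis by (rule UnI2)
      next
        case False
        then have "((Y, Y'), Y'') \<in> (SIGMA p:pairs t. ?A p)"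
          using p Y' by (auto simp: johnson_pairs_def)
        then have "x \<in> (\<lambda>((Y, Y'), Y''). ((Y, Y''), Y')) ` (SIGMA p:pairs t. ?A p)"
          by (rule rev_image_eqI) (simp add: x)
        then show ?thesis by (rule UnI1)
      qed
    qed
  qed
  also have "\<dots> \<le> card (SIGMA p:pairs t. ?A p) + card (SIGMA p:pairs 1. ?B p)"
    using finite_johnson_pairs fin
    by (intro order_trans[OF card_Un_le] add_mono card_image_le) auto
  also have "\<dots> = (\<Sum>p\<in>pairs t. card (?A p)) + (\<Sum>p\<in>pairs 1. card (?B p))"
    using finite_johnson_pairs fin by (subst (1 2) card_SigmaI) auto
  also have "\<dots> \<le> (\<Sum>p\<in>pairs t. (h - t)\<^sup>2) + (\<Sum>p\<in>pairs 1. ((h - 1) choose t)\<^sup>2)"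
  proof (intro add_mono sum_mono)
    fix p assume "p \<in> pairs t"
    then show "card (?A p) \<le> (h - t)\<^sup>2"
      using G by (auto simp: johnson_pairs_def intro!: card_after[unfolded One_nat_def])
  next
    fix p assume "p \<in> pairs 1"
    then show "card (?B p) \<le> ((h - 1) choose t)\<^sup>2"
      using G by (auto simp: johnson_pairs_def intro!: card_before[unfolded One_nat_def])
  qed
  finally show ?thesis by simp
qed

text \<open>The recursion unrolled. The absorption identities turn both of its terms into multiples
  of the square of \<open>(h - t) * (h choose t)\<close>, with coefficients \<open>t\<close> and
  1.\<close>

lemma johnson_pairs_le:
  assumes "t \<le> h"
  shows "card (pairs t) * h\<^sup>2 \<le> t * card (pairs 1) * (h choose t)\<^sup>2"
  using assms
proof (induction t)
  case 0
  have "pairs 0 = {}"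
  proof -
    have "Y = Y'" if "Y \<in> layer E h" "Y' \<in> layer E h" "card (Y - Y') = 0" for Y Y'
      using layer_facts[OF that(1)] layer_facts[OF that(2)] that(3)
      by (metis card_0_eq card_subset_eq finite_Diff Diff_eq_empty_iff)
    then show ?thesis using G by (auto simp: johnson_pairs_def)
  qed
  then show ?case by simp
next
  case (Suc t)
  let ?e = "\<lambda>t. card (pairs t)" and ?b = "(h - t) * (h choose t)"
  have b1: "?b = h * ((h - 1) choose t)" by (rule binomial_absorb_comp)
  have b2: "?b = Suc t * (h choose Suc t)" unfolding b1 by (rule binomial_absorption[symmetric])
  have "(?e (Suc t) * h\<^sup>2) * (Suc t)\<^sup>2 \<le> (?e t * (h - t)\<^sup>2 + ?e 1 * ((h - 1) choose t)\<^sup>2) * h\<^sup>2"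
    using mult_right_mono[OF johnson_pairs_Suc_le[of t], of "h\<^sup>2"] by (simp add: algebra_simps)
  also have "\<dots> = (?e t * h\<^sup>2) * (h - t)\<^sup>2 + ?e 1 * (h * ((h - 1) choose t))\<^sup>2"
    by (simp add: algebra_simps power_mult_distrib)
  also have "\<dots> \<le> (t * ?e 1 * (h choose t)\<^sup>2) * (h - t)\<^sup>2 + ?e 1 * ?b\<^sup>2"
    unfolding b1[symmetric] using Suc by (intro add_mono mult_right_mono) auto
  also have "\<dots> = Suc t * ?e 1 * ?b\<^sup>2"
  proof -
    have "(t * e * c\<^sup>2) * d\<^sup>2 + e * (d * c)\<^sup>2 = Suc t * e * (d * c)\<^sup>2" for e c d :: nat
      by (simp add: power_mult_distrib algebra_simps)
    then show ?thesis .
  qed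
  also have "\<dots> = (Suc t * ?e 1 * (h choose Suc t)\<^sup>2) * (Suc t)\<^sup>2"
    unfolding b2 by (simp only: power_mult_distrib mult_ac)
  finally show ?case by (subst (asm) mult_le_cancel2) simp
qed

text \<open>Join two independent uniform sets by a geodesic: it has expected length \<open>h / 2\<close>, and each of
  its steps is a uniform edge of the Johnson graph.\<close>

theorem johnson_poincare:
  "2 * h * (card G * ((2 * h choose h) - card G)) \<le> card (pairs 1) * (2 * h choose h)"
proof (cases "h = 0")
  case False
  let ?N = "2 * h choose h"
  have finG: "finite G" using G fE finite_subset finite_layer by blast
  have "G \<times> (layer E h - G) = (\<Union>t\<le>h. pairs t)"
  proof -
    have "card (Y - Y') \<le> h" if "Y \<in> layer E h" for Y Y'
      using layer_facts[OF that] card_mono[of Y "Y - Y'"] by auto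
    then show ?thesis using G by (auto simp: johnson_pairs_def)
  qed
  then have "card (G \<times> (layer E h - G)) = (\<Sum>t\<le>h. card (pairs t))"
    using finite_johnson_pairs
    by (simp only:) (rule card_UN_disjoint, auto simp: johnson_pairs_def)
  moreover have "card (layer E h - G) = ?N - card G"
    using G fE cE finG by (simp add: card_Diff_subset)
  ultimately have s: "card G * (?N - card G) = (\<Sum>t\<le>h. card (pairs t))"
    by (simp add: card_cartesian_product)
  \<comment> \<open>The reflection of \<open>t\<close> to \<open>h - t\<close> shows that the mean
    distance is \<open>h / 2\<close>.\<close>
  have "(\<Sum>t\<le>h. t * (h choose t)\<^sup>2) = (\<Sum>t\<le>h. (h - t) * (h choose t)\<^sup>2)"
    by (rule sum.reindex_bij_witness[where i = "\<lambda>t. h - t" and j = "\<lambda>t. h - t"])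
       (auto simp: binomial_symmetric[symmetric])
  then have "2 * (\<Sum>t\<le>h. t * (h choose t)\<^sup>2) = (\<Sum>t\<le>h. t * (h choose t)\<^sup>2 + (h - t) * (h choose t)\<^sup>2)"
    by (simp add: sum.distrib)
  also have "\<dots> = (\<Sum>t\<le>h. h * (h choose t)\<^sup>2)"
    by (intro sum.cong) (auto simp: add_mult_distrib[symmetric])
  also have "\<dots> = h * ?N" by (simp add: sum_distrib_left[symmetric] choose_square_sum)
  finally have m: "2 * (\<Sum>t\<le>h. t * (h choose t)\<^sup>2) = h * ?N" .
  have "h * (2 * h * (card G * (?N - card G))) = 2 * (\<Sum>t\<le>h. card (pairs t) * h\<^sup>2)"
    unfolding s by (simp add: sum_distrib_right[symmetric] power2_eq_square)
  also have "\<dots> \<le> 2 * (\<Sum>t\<le>h. t * card (pairs 1) * (h choose t)\<^sup>2)"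
    by (intro mult_left_mono sum_mono johnson_pairs_le) auto
  also have "\<dots> = card (pairs 1) * (2 * (\<Sum>t\<le>h. t * (h choose t)\<^sup>2))"
    by (simp add: sum_distrib_left mult_ac)
  also have "\<dots> = h * (card (pairs 1) * ?N)" unfolding m by simp
  finally show ?thesis using False by (simp only: mult_le_cancel1)
qed simp

end

text \<open>Every set of size \<open>j + d\<close> lies above the fraction \<open>q\<close> of layer
  \<open>j\<close>, so by averaging some \<open>A\<close> covers at least this fraction of what
  remains. A choice may repeat, hence only \<open>card \<A> \<le> m\<close>.\<close>

lemma greedy_cover:
  assumes E: "finite E" and j: "j + d \<le> card E"
  defines "q \<equiv> real ((j + d) choose j) / real (card E choose j)"
  shows "\<exists>\<A>. \<A> \<subseteq> layer E j \<and> card \<A> \<le> m \<and>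
    real (card {Z\<in>layer E (j + d). \<forall>A\<in>\<A>. \<not> A \<subseteq> Z}) \<le> real (card E choose (j + d)) * (1 - q) ^ m"
proof (induction m)
  case 0
  show ?case using E by (intro exI[of _ "{}"]) simp
next
  case (Suc m)
  then obtain \<A> where \<A>: "\<A> \<subseteq> layer E j" "card \<A> \<le> m"
    "real (card {Z\<in>layer E (j + d). \<forall>A\<in>\<A>. \<not> A \<subseteq> Z}) \<le> real (card E choose (j + d)) * (1 - q) ^ m"
    by blast
  let ?R = "{Z\<in>layer E (j + d). \<forall>A\<in>\<A>. \<not> A \<subseteq> Z}"
  have pos: "card E choose j > 0" using j by (simp add: zero_less_binomial)
  have q: "q \<le> 1"
    using pos j by (auto simp: q_def intro!: binomial_right_mono)
  have "(\<Sum>A\<in>layer E j. card {Z\<in>?R. A \<subseteq> Z}) = (\<Sum>A\<in>layer E j. \<Sum>Z\<in>?R. if A \<subseteq> Z then 1 else 0)"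
    using E by (simp add: sum.If_cases Int_def)
  also have "\<dots> = (\<Sum>Z\<in>?R. \<Sum>A\<in>layer E j. if A \<subseteq> Z then 1 else 0)" by (rule sum.swap)
  also have "\<dots> = (\<Sum>Z\<in>?R. (j + d) choose j)"
  proof (intro sum.cong refl)
    fix Z assume "Z \<in> ?R"
    then have Z: "Z \<subseteq> E" "finite Z" "card Z = j + d" using E by (auto simp: layer_def intro: finite_subset)
    have "{A\<in>layer E j. A \<subseteq> Z} = layer Z j" using Z by (auto simp: layer_def)
    then show "(\<Sum>A\<in>layer E j. if A \<subseteq> Z then 1 else 0) = (j + d) choose j"
      using E Z by (simp add: sum.If_cases Int_def)
  qed
  finally have sum: "(\<Sum>A\<in>layer E j. card {Z\<in>?R. A \<subseteq> Z}) = card ?R * ((j + d) choose j)" by simp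
  obtain A where A: "A \<in> layer E j" "card {Z\<in>?R. A \<subseteq> Z} \<ge> q * card ?R"
  proof (rule ccontr)
    assume *: "\<not> thesis"
    have "real (\<Sum>A\<in>layer E j. card {Z\<in>?R. A \<subseteq> Z}) < (\<Sum>A\<in>layer E j. q * card ?R)"
      unfolding of_nat_sum
    proof (rule sum_strict_mono)
      show "layer E j \<noteq> {}" using pos card_layer[OF E, of j] by (metis card.empty less_irrefl)
      show "real (card {Z\<in>?R. A \<subseteq> Z}) < q * card ?R" if "A \<in> layer E j" for A
        using * that \<open>\<And>A. A \<in> layer E j \<Longrightarrow> q * card ?R \<le> card {Z\<in>?R. A \<subseteq> Z} \<Longrightarrow> thesis\<close> by force
    qed (use E in simp)
    also have "\<dots> = real (card ?R * ((j + d) choose j))" using E pos by (simp add: q_def)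
    finally show False unfolding sum by simp
  qed
  let ?R' = "{Z\<in>layer E (j + d). \<forall>A'\<in>insert A \<A>. \<not> A' \<subseteq> Z}"
  have R': "?R' = ?R - {Z\<in>?R. A \<subseteq> Z}" by auto
  have "card ?R' = card ?R - card {Z\<in>?R. A \<subseteq> Z}"
    unfolding R' using E by (intro card_Diff_subset) auto
  moreover have "card {Z\<in>?R. A \<subseteq> Z} \<le> card ?R" using E by (intro card_mono) auto
  ultimately have "real (card ?R') = real (card ?R) - real (card {Z\<in>?R. A \<subseteq> Z})" by (simp add: of_nat_diff)
  also have "\<dots> \<le> (1 - q) * real (card ?R)" using A(2) by (simp add: algebra_simps)
  also have "\<dots> \<le> (1 - q) * (real (card E choose (j + d)) * (1 - q) ^ m)"
    using q \<A>(3) by (intro mult_left_mono) auto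
  finally have "real (card ?R') \<le> real (card E choose (j + d)) * (1 - q) ^ Suc m"
    by (simp add: mult.left_commute)
  moreover have "card (insert A \<A>) \<le> Suc m"
    using \<A>(2) finite_subset[OF \<A>(1)] E by (simp add: card_insert_if)
  ultimately show ?case using \<A>(1) A(1) by (intro exI[of _ "insert A \<A>"]) auto
qed

section \<open>Summing over one layer\<close>

lemma prod_powr_le:
  fixes c e :: "'i \<Rightarrow> real"
  assumes "\<And>i. i \<in> I \<Longrightarrow> 0 \<le> c i \<and> c i \<le> 2 powr e i"
  shows "(\<Prod>i\<in>I. c i powr (1 / real k)) \<le> 2 powr ((\<Sum>i\<in>I. e i) / real k)"
proof -
  have "(\<Prod>i\<in>I. c i powr (1 / real k)) \<le> (\<Prod>i\<in>I. (2 powr e i) powr (1 / real k))"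
    using assms by (intro prod_mono conjI powr_mono2) auto
  also have "\<dots> = 2 powr ((\<Sum>i\<in>I. e i) / real k)"
    by (simp add: powr_powr powr_sum sum_divide_distrib)
  finally show ?thesis .
qed

lemma cube_eq_powr: "(real t + 1) ^ 3 = 2 powr (3 * log 2 (real t + 1))"
proof -
  have "2 powr (3 * log 2 (real t + 1)) = (2 powr log 2 (real t + 1)) powr 3"
    by (simp only: powr_powr mult.commute)
  also have "\<dots> = (real t + 1) powr real 3" by simp
  also have "\<dots> = (real t + 1) ^ 3" by (rule powr_realpow) simp
  finally show ?thesis by simp
qed

text \<open>Layer \<open>i\<close> is two below the middle, so the blocks are the middle sets. A
  block in \<open>G0\<close> contains a set of \<open>A\<close>, hence has two covered points, and
  gains the exponent \<open>i + 3\<close>; every block loses a cubic factor.\<close>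

lemma shadow_sum_forced_le:
  assumes E: "finite E" "card E = 2 * i + 4" and F: "F \<subseteq> layer E i" and A: "A \<subseteq> layer E i"
    and G0: "G0 \<subseteq> layer E (i + 2)" "\<And>Z. Z \<in> G0 \<Longrightarrow> \<exists>X\<in>A. X \<subseteq> Z"
  defines "k \<equiv> (card E - i) choose 2"
  shows "(\<Sum>V | F \<union> A \<subseteq> V \<and> V \<subseteq> layer E i. 2 powr (- real (card (upper_shadow E V))))
    \<le> 2 powr (- real (card F)) * 2 powr ((real (card E choose (i + 2)) * (3 * log 2 (real i + 3))
        - (real i + 3) * card G0) / k)"
proof -
  let ?w = "\<lambda>s. real s * (real (card E) - i) / 2"
  let ?c = "\<lambda>Z. \<Sum>S | cover A Z \<subseteq> S \<and> S \<subseteq> Z. 2 powr (real (card S choose 2) - ?w (card S))"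
  let ?e = "\<lambda>Z. 3 * log 2 (real i + 3) - (if Z \<in> G0 then real i + 3 else 0)"
  have "(\<Sum>V | F \<union> A \<subseteq> V \<and> V \<subseteq> layer E i. 2 powr (- real (card (upper_shadow E V))))
    = (\<Sum>V | F \<union> A \<subseteq> V \<and> V \<subseteq> layer E i.
        \<Prod>Z\<in>layer E (i + 2). (2 powr (- ?w (card (cover V Z)))) powr (1/k))"
    unfolding k_def using E by (intro sum.cong refl upper_shadow_weight[symmetric]) auto
  also have "\<dots> \<le> 2 powr (- real (card F)) * (\<Prod>Z\<in>layer E (i + 2). ?c Z powr (1/k))"
    unfolding k_def using E by (intro layer_step F A) auto
  also have "\<dots> \<le> 2 powr (- real (card F)) * 2 powr ((\<Sum>Z\<in>layer E (i + 2). ?e Z) / k)"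
  proof (intro mult_left_mono prod_powr_le conjI)
    fix Z assume Z: "Z \<in> layer E (i + 2)"
    then have fZ: "finite Z" "card Z = i + 2" "Z \<subseteq> E" using E by (auto simp: layer_def intro: finite_subset)
    have l: "2 powr (3 * log 2 (real i + 3)) = (real (i + 2) + 1) ^ 3"
      unfolding cube_eq_powr by (simp add: algebra_simps)
    show "?c Z \<le> 2 powr ?e Z"
    proof (cases "Z \<in> G0")
      case True
      then obtain X where X: "X \<in> A" "X \<subseteq> Z" using G0(2) by blast
      have "card (Z - X) = 2"
        using X A fZ by (auto simp: layer_def card_Diff_subset finite_subset)
      moreover have "Z - X \<subseteq> cover A Z" using X by (auto simp: cover_def)
      ultimately have "card (cover A Z) \<ge> 2"
        using fZ by (metis card_mono cover_subset finite_subset)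
      then have "?c Z \<le> (real (i + 2) + 1) ^ 3 * 2 powr (- (real (i + 2) + 1))"
        using fZ E by (intro cover_weight_sum_forced_le) auto
      also have "\<dots> = 2 powr ?e Z"
        using True unfolding l[symmetric] powr_add[symmetric] by (simp add: algebra_simps)
      finally show ?thesis .
    next
      case False
      have "?c Z \<le> (\<Sum>S | S \<subseteq> Z. 2 powr (real (card S choose 2) - ?w (card S)))"
        using fZ by (intro sum_mono2) auto
      also have "\<dots> \<le> (real (i + 2) + 1) ^ 3"
        using fZ E by (intro cover_weight_sum_le) auto
      finally show ?thesis using False l by simp
    qed
  qed (auto intro: sum_nonneg)
  also have "(\<Sum>Z\<in>layer E (i + 2). ?e Z) = real (card E choose (i + 2)) * (3 * log 2 (real i + 3))
        - (real i + 3) * card G0"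
  proof -
    have "layer E (i + 2) \<inter> {Z. Z \<in> G0} = G0" using G0(1) by auto
    then show ?thesis using E G0(1) by (simp add: sum_subtractf sum.If_cases mult.commute)
  qed
  finally show ?thesis .
qed

lemma shadow_sum_le:
  assumes E: "finite E" "2 * i + 2 \<le> card E" and F: "F \<subseteq> layer E i"
  defines "k \<equiv> (card E - i) choose 2"
  shows "(\<Sum>V | F \<subseteq> V \<and> V \<subseteq> layer E i. 2 powr (- real (card (upper_shadow E V))))
    \<le> 2 powr (- real (card F)) * 2 powr (real (card E choose (i + 2)) * (3 * log 2 (real i + 3)) / k)"
proof -
  let ?w = "\<lambda>s. real s * (real (card E) - i) / 2"
  let ?c = "\<lambda>Z. \<Sum>S | cover {} Z \<subseteq> S \<and> S \<subseteq> Z. 2 powr (real (card S choose 2) - ?w (card S))"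
  have "(\<Sum>V | F \<subseteq> V \<and> V \<subseteq> layer E i. 2 powr (- real (card (upper_shadow E V))))
    = (\<Sum>V | F \<union> {} \<subseteq> V \<and> V \<subseteq> layer E i.
        \<Prod>Z\<in>layer E (i + 2). (2 powr (- ?w (card (cover V Z)))) powr (1/k))"
    unfolding k_def using E by (intro sum.cong upper_shadow_weight[symmetric]) auto
  also have "\<dots> \<le> 2 powr (- real (card F)) * (\<Prod>Z\<in>layer E (i + 2). ?c Z powr (1/k))"
    unfolding k_def using E by (intro layer_step F) auto
  also have "\<dots> \<le> 2 powr (- real (card F)) * 2 powr ((\<Sum>Z\<in>layer E (i + 2). 3 * log 2 (real i + 3)) / k)"
  proof (intro mult_left_mono prod_powr_le conjI)
    fix Z assume Z: "Z \<in> layer E (i + 2)"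
    then have fZ: "finite Z" "card Z = i + 2" "Z \<subseteq> E" using E by (auto simp: layer_def intro: finite_subset)
    have l: "2 powr (3 * log 2 (real i + 3)) = (real (i + 2) + 1) ^ 3"
      unfolding cube_eq_powr by (simp add: algebra_simps)
    have "?c Z \<le> (\<Sum>S | S \<subseteq> Z. 2 powr (real (card S choose 2) - ?w (card S)))"
      using fZ by (intro sum_mono2) auto
    also have "\<dots> \<le> (real (i + 2) + 1) ^ 3"
      using fZ E by (intro cover_weight_sum_le) auto
    finally show "?c Z \<le> 2 powr (3 * log 2 (real i + 3))" using l by simp
  qed (auto intro: sum_nonneg)
  finally show ?thesis using E by simp
qed

text \<open>By symmetry let s be at most t / 2. Then \<open>t choose s\<close> is at most t^s, which
  is at most 2^(s t / 16), while t - s is at least t / 2.\<close>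

lemma binomial_mult_powr_le_1:
  assumes s: "s \<le> t" and t: "real t \<le> 2 powr (real t / 16)"
  shows "real (t choose s) * 2 powr (- (real s * (real t - real s) / 8)) \<le> 1"
proof (cases "t = 0")
  case False
  have pow: "real (t choose m) \<le> 2 powr (real t / 16 * real m)" if "m \<le> t" for m
  proof -
    have "real (t choose m) \<le> real t ^ m" using binomial_le_pow[OF that] by (metis of_nat_le_iff of_nat_power)
    also have "\<dots> \<le> (2 powr (real t / 16)) ^ m" using t by (intro power_mono) auto
    also have "\<dots> = 2 powr (real t / 16 * real m)" by (simp add: powr_powr flip: powr_realpow)
    finally show ?thesis .
  qed
  have "real (t choose s) \<le> 2 powr (real s * (real t - real s) / 8)"
  proof (cases "2 * s \<le> t")
    case True
    have "real t * real s \<le> (2 * (real t - real s)) * real s" using True by (intro mult_right_mono) auto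
    then have "real t / 16 * real s \<le> real s * (real t - real s) / 8" by (simp add: algebra_simps)
    then show ?thesis using pow[OF s] by (smt (verit, best) powr_mono)
  next
    case False
    then have "real t * (real t - real s) \<le> (2 * real s) * (real t - real s)" using s by (intro mult_right_mono) auto
    then have "real t / 16 * real (t - s) \<le> real s * (real t - real s) / 8" unfolding of_nat_diff[OF s] by (simp add: field_simps)
    then show ?thesis using pow[of "t - s"] s binomial_symmetric[OF s] by (smt (verit, best) powr_mono diff_le_self)
  qed
  then have "real (t choose s) * 2 powr (- (real s * (real t - real s) / 8))
    \<le> 2 powr (real s * (real t - real s) / 8) * 2 powr (- (real s * (real t - real s) / 8))"
    by (intro mult_right_mono) auto
  then show ?thesis by (simp add: powr_minus)
qed (use s in simp)

text \<open>In the middle layers the Poincare inequality gains a further factor. The weight \<open>3/8\<close> given to it may be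
  any number below \<open>1/2\<close>: the rest is needed to absorb the number of sets \<open>S\<close> of non-isolated vertices.\<close>

lemma shadow_sum_top_le:
  assumes E: "finite E" "card E = 2 * h" and h: "h = Suc i" and F: "F \<subseteq> layer E i"
    and \<kappa>: "\<And>g. card (upper_shadow E F) \<le> g \<Longrightarrow> g \<le> 2 * h choose h \<Longrightarrow>
       \<kappa> * real (2 * h choose h) \<le> real g + 3/2 * real g * (real (2 * h choose h) - real g) / real (2 * h choose h)"
    and large: "real h + 1 \<le> 2 powr ((real h + 1) / 16)"
  defines "k \<equiv> (card E - i) choose 2"
  shows "(\<Sum>V | F \<subseteq> V \<and> V \<subseteq> layer E i. 2 powr (- real (card (upper_shadow E V))))
    \<le> 2 powr (- \<kappa> * real (2 * h choose h) / (real h + 1)) *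
      (2 powr (- real (card F)) * 2 powr (real (card E choose (i + 2)) * (3 * log 2 (real i + 3)) / k))"
proof -
  let ?N = "real (2 * h choose h)" and ?t = "real h + 1"
  \<comment> \<open>From the exact shadow weight \<open>?t * s / 2\<close>, two parts are given
    away: \<open>s / 2\<close>, in total g / (h + 1), for the difference of the layer sizes, and 3/8
    of the boundary. Then \<open>(s choose 2) - ?w s\<close> is - s (t - s) / 8, so the empty and
    the full cover cost nothing and all others are suppressed.\<close>
  let ?w = "\<lambda>s. ?t * real s / 2 - real s / 2 - 3/8 * (real s * (?t - real s))"
  let ?c = "\<lambda>Z. \<Sum>S | cover {} Z \<subseteq> S \<and> S \<subseteq> Z. 2 powr (real (card S choose 2) - ?w (card S))"
  let ?M = "layer E (i + 2)"
  have k: "real k = real h * (real h + 1) / 2"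
    unfolding k_def real_choose_two using E h by (simp add: of_nat_diff algebra_simps)
  have N: "?N > 0" by (simp add: zero_less_binomial)
  have weight: "2 powr (- real (card (upper_shadow E V)))
     \<le> 2 powr (- \<kappa> * ?N / ?t) * (\<Prod>Z\<in>?M. (2 powr (- ?w (card (cover V Z)))) powr (1/k))"
    if V: "F \<subseteq> V" "V \<subseteq> layer E i" for V
  proof -
    let ?G = "upper_shadow E V"
    let ?g = "real (card ?G)" and ?s = "\<lambda>Z. real (card (cover V Z))"
    have G: "?G \<subseteq> layer E h" using upper_shadow_subset_layer[OF V(2)] h by simp
    have gN: "card ?G \<le> 2 * h choose h" using card_mono[OF _ G] E by simp
    have sle: "card (cover V Z) \<le> i + 2" if "Z \<in> ?M" for Z
      using that card_mono[OF finite_layer_mem[OF E(1) that] cover_subset] by (auto simp: layer_def)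
    have "real (\<Sum>Z\<in>?M. card (cover V Z)) = real (h * card ?G)"
      unfolding sum_card_cover[OF E(1) V(2)] using E h by simp
    then have s1: "(\<Sum>Z\<in>?M. ?s Z) = real h * ?g" by simp
    have "real (\<Sum>Z\<in>?M. card (cover V Z) * (i + 2 - card (cover V Z))) = real (card (johnson_pairs E h 1 ?G))"
      unfolding sum_cover_boundary[OF E(1) V(2)] h by simp
    moreover have "real (\<Sum>Z\<in>?M. card (cover V Z) * (i + 2 - card (cover V Z))) = (\<Sum>Z\<in>?M. ?s Z * (?t - ?s Z))"
      unfolding of_nat_sum
    proof (intro sum.cong refl)
      fix Z assume "Z \<in> ?M"
      then show "real (card (cover V Z) * (i + 2 - card (cover V Z))) = ?s Z * (?t - ?s Z)"
        using h by (simp only: of_nat_mult of_nat_diff[OF sle]) simp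
    qed
    ultimately have s2: "(\<Sum>Z\<in>?M. ?s Z * (?t - ?s Z)) = real (card (johnson_pairs E h 1 ?G))" by simp
    have "real (2 * h * (card ?G * ((2 * h choose h) - card ?G))) \<le> real (card (johnson_pairs E h 1 ?G) * (2 * h choose h))"
      by (rule of_nat_mono[OF johnson_poincare[OF E G]])
    then have poincare: "2 * real h * (?g * (?N - ?g)) \<le> (\<Sum>Z\<in>?M. ?s Z * (?t - ?s Z)) * ?N"
      unfolding s2 of_nat_mult of_nat_diff[OF gN] by (simp only: of_nat_numeral mult_ac)
    have "\<kappa> * ?N \<le> ?g + 3/2 * ?g * (?N - ?g) / ?N"
      using \<kappa>[of "card ?G"] gN card_mono[OF _ upper_shadow_mono[OF V(1)], of E] E by auto
    also have "3/2 * ?g * (?N - ?g) / ?N \<le> 3/4 * (\<Sum>Z\<in>?M. ?s Z * (?t - ?s Z)) / real h"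
      using poincare N h by (simp add: field_simps)
    finally have kap: "\<kappa> * ?N \<le> ?g + 3/4 * (\<Sum>Z\<in>?M. ?s Z * (?t - ?s Z)) / real h" by simp
    have "(\<Sum>Z\<in>?M. ?w (card (cover V Z))) = ?t / 2 * (\<Sum>Z\<in>?M. ?s Z) - (\<Sum>Z\<in>?M. ?s Z) / 2
        - 3/8 * (\<Sum>Z\<in>?M. ?s Z * (?t - ?s Z))"
      by (simp only: sum_subtractf sum_distrib_left sum_divide_distrib) (simp add: algebra_simps)
    also have "\<dots> = (?t * (real h * ?g) - real h * ?g) / 2 - 3/8 * (\<Sum>Z\<in>?M. ?s Z * (?t - ?s Z))"
      unfolding s1 by (simp add: field_simps)
    finally have w: "(\<Sum>Z\<in>?M. ?w (card (cover V Z))) = \<dots>" .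
    have arith: "((H + 1) * (H * g) - H * g) / 2 / (H * (H + 1) / 2) - 3/8 * Q / (H * (H + 1) / 2)
      = g - (g + 3/4 * Q / H) / (H + 1)" if "H > 0" for H g Q :: real
      using that by (simp add: divide_simps) (simp add: algebra_simps)
    have "(\<Sum>Z\<in>?M. ?w (card (cover V Z))) / k
      = ?g - (?g + 3/4 * (\<Sum>Z\<in>?M. ?s Z * (?t - ?s Z)) / real h) / ?t"
      unfolding w k diff_divide_distrib[of _ "3/8 * _"] by (rule arith) (use h in simp)
    also have "\<dots> \<le> ?g - \<kappa> * ?N / ?t"
      using kap by (intro diff_left_mono divide_right_mono) auto
    finally have main: "- ?g \<le> - \<kappa> * ?N / ?t - (\<Sum>Z\<in>?M. ?w (card (cover V Z))) / k" by simp
    have "(\<Prod>Z\<in>?M. (2 powr (- ?w (card (cover V Z)))) powr (1/k)) = 2 powr (\<Sum>Z\<in>?M. - ?w (card (cover V Z)) * (1 / k))"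
      by (simp only: powr_powr powr_sum)
    also have "(\<Sum>Z\<in>?M. - ?w (card (cover V Z)) * (1 / k)) = - ((\<Sum>Z\<in>?M. ?w (card (cover V Z))) / k)"
    proof -
      have "- x * (1 / y) = - (x / y)" for x y :: real by simp
      then show ?thesis by (simp only: sum_negf sum_divide_distrib)
    qed
    finally show ?thesis using main by (simp add: powr_add[symmetric])
  qed
  have "(\<Sum>V | F \<subseteq> V \<and> V \<subseteq> layer E i. 2 powr (- real (card (upper_shadow E V))))
    \<le> (\<Sum>V | F \<union> {} \<subseteq> V \<and> V \<subseteq> layer E i. 2 powr (- \<kappa> * ?N / ?t) *
        (\<Prod>Z\<in>?M. (2 powr (- ?w (card (cover V Z)))) powr (1/k)))"
    using weight by (simp only: Un_empty_right) (intro sum_mono, auto)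
  also have "\<dots> = 2 powr (- \<kappa> * ?N / ?t) * (\<Sum>V | F \<union> {} \<subseteq> V \<and> V \<subseteq> layer E i.
        (\<Prod>Z\<in>?M. (2 powr (- ?w (card (cover V Z)))) powr (1/k)))"
    by (rule sum_distrib_left[symmetric])
  also have "\<dots> \<le> 2 powr (- \<kappa> * ?N / ?t) * (2 powr (- real (card F)) * (\<Prod>Z\<in>?M. ?c Z powr (1/k)))"
    unfolding k_def using E h by (intro mult_left_mono layer_step F) auto
  also have "\<dots> \<le> 2 powr (- \<kappa> * ?N / ?t) * (2 powr (- real (card F)) *
      2 powr ((\<Sum>Z\<in>?M. 3 * log 2 (real i + 3)) / k))"
  proof (intro mult_left_mono prod_powr_le conjI)
    fix Z assume Z: "Z \<in> ?M"
    then have fZ: "finite Z" "card Z = h + 1" "Z \<subseteq> E" using E h by (auto simp: layer_def intro: finite_subset)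
    have "?c Z = (\<Sum>S\<in>Pow Z. 2 powr (real (card S choose 2) - ?w (card S)))"
      by (simp add: cover_def Pow_def)
    also have "\<dots> = (\<Sum>s\<le>h+1. real ((h + 1) choose s) * 2 powr (real (s choose 2) - ?w s))"
      using sum_subsets_by_card[OF fZ(1), of "\<lambda>s. 2 powr (real (s choose 2) - ?w s)"] fZ(2) by simp
    also have "\<dots> \<le> (\<Sum>s\<le>h+1. 1)"
    proof (intro sum_mono)
      fix s assume "s \<in> {..h+1}"
      then have s: "s \<le> h + 1" by simp
      have "real (s choose 2) - ?w s = - (real s * (real (h + 1) - real s) / 8)"
        unfolding real_choose_two by (simp add: field_simps)
      then show "real ((h + 1) choose s) * 2 powr (real (s choose 2) - ?w s) \<le> 1"
        using binomial_mult_powr_le_1[OF s] large by (simp add: add.commute)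
    qed
    also have "\<dots> = (real i + 3)" using h by simp
    also have "\<dots> \<le> (real (i + 2) + 1) ^ 3" by (simp add: power3_eq_cube algebra_simps)
    also have "\<dots> = 2 powr (3 * log 2 (real i + 3))"
      unfolding cube_eq_powr by (simp add: algebra_simps)
    finally show "?c Z \<le> 2 powr (3 * log 2 (real i + 3))" .
  qed (auto intro: sum_nonneg)
  finally show ?thesis using E by simp
qed

section \<open>Counting up-sets that contain prescribed sets\<close>

text \<open>The exponent lost at layer \<open>l\<close>: one factor (l + 3)^3 for each block of size
  \<open>l + 2\<close>, damped by the Finner exponent.\<close>

definition level_error :: "nat \<Rightarrow> nat \<Rightarrow> real" where
  "level_error n l = real (n choose (l + 2)) * (3 * log 2 (real l + 3)) / real ((n - l) choose 2)"

lemma up_families_Un_layer: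
  assumes "U' \<in> up_families E j" "V \<subseteq> layer E (Suc j)"
  shows "(U' \<union> V) \<inter> layer E (Suc j) = V"
  using up_families_disjoint_layer[OF assms(1)] assms(2) by auto

lemma shadow_sum_up_families_le:
  assumes E: "finite E" and i: "2 * i + 2 \<le> card E"
  shows "(\<Sum>U\<in>up_families E i. 2 powr (- real (card (upper_shadow E (U \<inter> layer E i)))))
    \<le> 2 powr (\<Sum>l=1..i. level_error (card E) l)"
  using i
proof (induction i)
  case 0
  then show ?case using E by (simp add: upper_shadow_def)
next
  case (Suc i)
  let ?e = "level_error (card E) (Suc i)"
  have "(\<Sum>U\<in>up_families E (Suc i). 2 powr (- real (card (upper_shadow E (U \<inter> layer E (Suc i))))))
    = (\<Sum>U'\<in>up_families E i. \<Sum>V | upper_shadow E (U' \<inter> layer E i) \<subseteq> V \<and> V \<subseteq> layer E (Suc i).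
        2 powr (- real (card (upper_shadow E V))))"
    unfolding sum_up_families_Suc[OF E]
    by (intro sum.cong refl) (simp add: up_families_Un_layer)
  also have "\<dots> \<le> (\<Sum>U'\<in>up_families E i. 2 powr (- real (card (upper_shadow E (U' \<inter> layer E i)))) * 2 powr ?e)"
    unfolding level_error_def using E Suc.prems
    by (intro sum_mono shadow_sum_le upper_shadow_subset_layer) auto
  also have "\<dots> = (\<Sum>U'\<in>up_families E i. 2 powr (- real (card (upper_shadow E (U' \<inter> layer E i))))) * 2 powr ?e"
    by (rule sum_distrib_right[symmetric])
  also have "\<dots> \<le> 2 powr (\<Sum>l=1..i. level_error (card E) l) * 2 powr ?e"
    using Suc by (intro mult_right_mono) auto
  also have "\<dots> = 2 powr (\<Sum>l=1..Suc i. level_error (card E) l)"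
    by (simp add: powr_add)
  finally show ?case .
qed

text \<open>Each layer uses the factor 2^(- size of its shadow) left by the layer above and leaves
  the same kind of factor to the layer below. Gains enter at two places: \<kappa> at layer
  \<open>h - 1\<close> and \<open>card G0\<close> at layer \<open>h - 2\<close>.\<close>

lemma card_up_families_containing_le:
  assumes E: "finite E" "card E = 2 * h" and h: "h = p + 3" and A: "A \<subseteq> layer E (h - 2)"
  defines "G0 \<equiv> {Z\<in>layer E h. \<exists>X\<in>A. X \<subseteq> Z}"
  assumes \<kappa>: "\<And>g. card G0 \<le> g \<Longrightarrow> g \<le> 2 * h choose h \<Longrightarrow>
       \<kappa> * real (2 * h choose h) \<le> real g + 3/2 * real g * (real (2 * h choose h) - real g) / real (2 * h choose h)"
    and large: "real h + 1 \<le> 2 powr ((real h + 1) / 16)"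
  shows "real (card {U\<in>up_families E h. A \<subseteq> U})
    \<le> 2 powr (real (2 * h choose h) - \<kappa> * real (2 * h choose h) / (real h + 1)
        - (real h + 1) * card G0 / real ((h + 2) choose 2) + (\<Sum>l=1..h-1. level_error (2 * h) l))"
proof -
  let ?N = "real (2 * h choose h)" and ?i = "Suc p"
  let ?sh = "upper_shadow E" and ?L = "layer E"
  let ?top = "\<lambda>j U. real (card (?sh (U \<inter> ?L j)))"
  let ?K = "2 powr (- \<kappa> * ?N / (real h + 1))"
  let ?fe = "level_error (2 * h) ?i - (real h + 1) * card G0 / real ((h + 2) choose 2)"
  have A': "A \<subseteq> ?L ?i" using A h by simp
  have h': "h = Suc (Suc ?i)" using h by simp
  have "?i + 2 = h" using h by simp
  then have G0: "G0 \<subseteq> ?L (?i + 2)" by (simp only:) (auto simp: G0_def)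
  have disj: "A \<subseteq> U \<union> V \<longleftrightarrow> A \<subseteq> U" if "V \<subseteq> ?L j" "j \<noteq> ?i" for U V j
  proof -
    have "A \<inter> V = {}" using A' that by (auto simp: layer_def)
    then show ?thesis by auto
  qed
  have sh_sub: "?sh (U \<inter> ?L j) \<subseteq> ?L (Suc j)" for U j
    by (rule upper_shadow_subset_layer) simp
  have "real (card {U\<in>up_families E h. A \<subseteq> U}) = (\<Sum>U\<in>up_families E h. if A \<subseteq> U then 1 else 0)"
    using E by (simp add: sum.If_cases Int_def)
  also have "\<dots> = (\<Sum>U\<in>up_families E (Suc ?i). \<Sum>V | ?sh (U \<inter> ?L (Suc ?i)) \<subseteq> V \<and> V \<subseteq> ?L h.
      if A \<subseteq> U \<union> V then 1 else 0)"
    unfolding h' sum_up_families_Suc[OF E(1)] by simp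
  also have "\<dots> = (\<Sum>U\<in>up_families E (Suc ?i). if A \<subseteq> U then 2 powr (?N - ?top (Suc ?i) U) else 0)"
  proof (intro sum.cong refl)
    fix U
    let ?F = "?sh (U \<inter> ?L (Suc ?i))"
    have F: "?F \<subseteq> ?L h" using sh_sub[of U "Suc ?i"] h' by simp
    have "(\<Sum>V | ?F \<subseteq> V \<and> V \<subseteq> ?L h. if A \<subseteq> U \<union> V then 1 else 0)
      = (\<Sum>V | ?F \<subseteq> V \<and> V \<subseteq> ?L h. if A \<subseteq> U then 1 else (0::real))"
      using disj[of _ h U] h' by (intro sum.cong) auto
    also have "\<dots> = (if A \<subseteq> U then real (card {V. ?F \<subseteq> V \<and> V \<subseteq> ?L h}) else 0)" by simp
    also have "real (card {V. ?F \<subseteq> V \<and> V \<subseteq> ?L h}) = 2 powr (real (card (?L h)) - real (card ?F))"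
    proof -
      have "card ?F \<le> card (?L h)" using F E by (intro card_mono) auto
      then have "real (card (?L h)) - real (card ?F) = real (card (?L h) - card ?F)" by (simp add: of_nat_diff)
      then have "2 powr (real (card (?L h)) - real (card ?F)) = 2 ^ (card (?L h) - card ?F)"
        by (simp only:) (rule powr_realpow, simp)
      moreover have "card {V. ?F \<subseteq> V \<and> V \<subseteq> ?L h} = 2 ^ (card (?L h) - card ?F)"
        using F E by (intro card_interval_sets) auto
      ultimately show ?thesis by (simp only: of_nat_power of_nat_numeral)
    qed
    finally show "(\<Sum>V | ?F \<subseteq> V \<and> V \<subseteq> ?L h. if A \<subseteq> U \<union> V then 1 else 0)
      = (if A \<subseteq> U then 2 powr (?N - ?top (Suc ?i) U) else 0)" using E by simp
  qed
  also have "\<dots> = (\<Sum>U\<in>up_families E ?i. \<Sum>V | ?sh (U \<inter> ?L ?i) \<subseteq> V \<and> V \<subseteq> ?L (Suc ?i).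
      if A \<subseteq> U \<union> V then 2 powr (?N - ?top (Suc ?i) (U \<union> V)) else 0)"
    by (rule sum_up_families_Suc[OF E(1)])
  also have "\<dots> \<le> (\<Sum>U\<in>up_families E ?i. if A \<subseteq> U then 2 powr ?N * (?K * (2 powr (- ?top ?i U) * 2 powr level_error (2 * h) (Suc ?i))) else 0)"
  proof (intro sum_mono)
    fix U assume U: "U \<in> up_families E ?i"
    let ?F = "?sh (U \<inter> ?L ?i)"
    have "(\<Sum>V | ?F \<subseteq> V \<and> V \<subseteq> ?L (Suc ?i). if A \<subseteq> U \<union> V then 2 powr (?N - ?top (Suc ?i) (U \<union> V)) else 0)
      = (\<Sum>V | ?F \<subseteq> V \<and> V \<subseteq> ?L (Suc ?i). if A \<subseteq> U then 2 powr ?N * 2 powr (- real (card (?sh V))) else 0)"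
      using disj[of _ "Suc ?i" U] up_families_Un_layer[OF U]
      by (intro sum.cong) (auto simp: powr_add[symmetric])
    also have "\<dots> = (if A \<subseteq> U then 2 powr ?N * (\<Sum>V | ?F \<subseteq> V \<and> V \<subseteq> ?L (Suc ?i). 2 powr (- real (card (?sh V)))) else 0)"
      by (simp add: sum_distrib_left)
    also have "\<dots> \<le> (if A \<subseteq> U then 2 powr ?N * (?K * (2 powr (- ?top ?i U) * 2 powr level_error (2 * h) (Suc ?i))) else 0)"
    proof (cases "A \<subseteq> U")
      case True
      \<comment> \<open>The middle sets above \<open>A\<close> lie in its second shadow, which
        supplies the lower bound on \<open>g\<close> demanded by the hypothesis on \<kappa>.\<close>
      have "G0 \<subseteq> ?sh ?F"
      proof
        fix Z assume "Z \<in> G0"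
        then obtain X where X: "X \<in> A" "X \<subseteq> Z" and Z: "Z \<subseteq> E" "card Z = h"
          by (auto simp: G0_def layer_def)
        have cX: "card X = ?i" "X \<subseteq> E" using X A' by (auto simp: layer_def)
        have "finite Z" using Z E finite_subset by blast
        then obtain Y where Y: "X \<subseteq> Y" "Y \<subseteq> Z" "card Y = Suc ?i"
          using exists_subset_between[of X "Suc ?i" Z] X cX Z h' by auto
        have "Y \<in> ?F"
          unfolding upper_shadow_def using X cX Y Z True A' by auto
        then show "Z \<in> ?sh ?F"
          unfolding upper_shadow_def[of E ?F] using Y Z h' by auto
      qed
      then have "card G0 \<le> card (?sh ?F)" using E by (intro card_mono) auto
      then have "(\<Sum>V | ?F \<subseteq> V \<and> V \<subseteq> ?L (Suc ?i). 2 powr (- real (card (?sh V))))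
        \<le> ?K * (2 powr (- real (card ?F)) * 2 powr (real (card E choose (Suc ?i + 2)) * (3 * log 2 (real (Suc ?i) + 3)) / real ((card E - Suc ?i) choose 2)))"
        using \<kappa> by (intro shadow_sum_top_le[OF E h' sh_sub _ large]) (auto intro: le_trans)
      then show ?thesis using True E by (simp add: level_error_def)
    qed simp
    finally show "(\<Sum>V | ?F \<subseteq> V \<and> V \<subseteq> ?L (Suc ?i). if A \<subseteq> U \<union> V then 2 powr (?N - ?top (Suc ?i) (U \<union> V)) else 0)
      \<le> (if A \<subseteq> U then 2 powr ?N * (?K * (2 powr (- ?top ?i U) * 2 powr level_error (2 * h) (Suc ?i))) else 0)" .
  qed
  also have "\<dots> = 2 powr ?N * ?K * 2 powr level_error (2 * h) (Suc ?i) *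
      (\<Sum>U\<in>up_families E ?i. if A \<subseteq> U then 2 powr (- ?top ?i U) else 0)"
    by (simp only: sum_distrib_left) (intro sum.cong, auto)
  also have "(\<Sum>U\<in>up_families E ?i. if A \<subseteq> U then 2 powr (- ?top ?i U) else 0)
    = (\<Sum>U\<in>up_families E p. \<Sum>V | ?sh (U \<inter> ?L p) \<subseteq> V \<and> V \<subseteq> ?L ?i.
        if A \<subseteq> U \<union> V then 2 powr (- ?top ?i (U \<union> V)) else 0)"
    by (rule sum_up_families_Suc[OF E(1)])
  also have "\<dots> \<le> (\<Sum>U\<in>up_families E p. 2 powr (- ?top p U) * 2 powr ?fe)"
  proof (intro sum_mono)
    fix U assume U: "U \<in> up_families E p"
    let ?F = "?sh (U \<inter> ?L p)"
    have dU: "A \<subseteq> U \<union> V \<longleftrightarrow> A \<subseteq> V" for V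
      using A' up_families_disjoint_layer[OF U] by auto
    have "(\<Sum>V | ?F \<subseteq> V \<and> V \<subseteq> ?L ?i. if A \<subseteq> U \<union> V then 2 powr (- ?top ?i (U \<union> V)) else 0)
      = (\<Sum>V | ?F \<subseteq> V \<and> V \<subseteq> ?L ?i. if A \<subseteq> V then 2 powr (- real (card (?sh V))) else 0)"
      by (intro sum.cong refl) (simp add: dU up_families_Un_layer[OF U])
    also have "\<dots> = (\<Sum>V\<in>{V\<in>{V. ?F \<subseteq> V \<and> V \<subseteq> ?L ?i}. A \<subseteq> V}. 2 powr (- real (card (?sh V))))"
    proof (rule sum.inter_filter[symmetric])
      show "finite {V. ?F \<subseteq> V \<and> V \<subseteq> ?L ?i}"
        by (rule finite_subset[of _ "Pow (?L ?i)"]) (use E in auto)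
    qed
    also have "{V\<in>{V. ?F \<subseteq> V \<and> V \<subseteq> ?L ?i}. A \<subseteq> V} = {V. ?F \<union> A \<subseteq> V \<and> V \<subseteq> ?L ?i}" by auto
    also have "(\<Sum>V | ?F \<union> A \<subseteq> V \<and> V \<subseteq> ?L ?i. 2 powr (- real (card (?sh V))))
      \<le> 2 powr (- real (card ?F)) * 2 powr ((real (card E choose (?i + 2)) * (3 * log 2 (real ?i + 3))
        - (real ?i + 3) * card G0) / real ((card E - ?i) choose 2))"
      using E h by (intro shadow_sum_forced_le sh_sub A' G0) (auto simp: G0_def)
    also have "(real (card E choose (?i + 2)) * (3 * log 2 (real ?i + 3))
        - (real ?i + 3) * card G0) / real ((card E - ?i) choose 2) = ?fe"
    proof -
      have "2 * h - ?i = h + 2" "real ?i + 3 = real h + 1" using h by auto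
      then show ?thesis using E unfolding level_error_def by (simp add: diff_divide_distrib)
    qed
    finally show "(\<Sum>V | ?F \<subseteq> V \<and> V \<subseteq> ?L ?i. if A \<subseteq> U \<union> V then 2 powr (- ?top ?i (U \<union> V)) else 0)
      \<le> 2 powr (- ?top p U) * 2 powr ?fe" .
  qed
  also have "\<dots> = (\<Sum>U\<in>up_families E p. 2 powr (- ?top p U)) * 2 powr ?fe"
    by (rule sum_distrib_right[symmetric])
  also have "\<dots> \<le> 2 powr (\<Sum>l=1..p. level_error (2 * h) l) * 2 powr ?fe"
    using shadow_sum_up_families_le[OF E(1), of p] E h by (intro mult_right_mono) auto
  finally have "real (card {U\<in>up_families E h. A \<subseteq> U}) \<le> 2 powr ?N * ?K * 2 powr level_error (2 * h) (Suc ?i) *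
      (2 powr (\<Sum>l=1..p. level_error (2 * h) l) * 2 powr ?fe)"
    by (simp add: mult_left_mono)
  also have "\<dots> = 2 powr (?N + (- \<kappa> * ?N / (real h + 1)) + level_error (2 * h) (Suc ?i)
      + ((\<Sum>l=1..p. level_error (2 * h) l) + ?fe))"
    by (simp only: powr_add)
  also have "?N + (- \<kappa> * ?N / (real h + 1)) + level_error (2 * h) (Suc ?i)
      + ((\<Sum>l=1..p. level_error (2 * h) l) + ?fe) = ?N - \<kappa> * ?N / (real h + 1)
        - (real h + 1) * card G0 / real ((h + 2) choose 2) + (\<Sum>l=1..h-1. level_error (2 * h) l)"
  proof -
    have "h - 1 = Suc (Suc p)" using h by simp
    then show ?thesis by simp
  qed
  finally show ?thesis .
qed

section \<open>Accumulated error and central binomial coefficient\<close>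

text \<open>Both sides equal \<open>(n choose l) / ((l + 2) choose 2)\<close>. On the right the
  denominator no longer depends on \<open>l\<close>, so the errors sum to a row of Pascal's
  triangle.\<close>

lemma binomial_layer_ratio:
  assumes "l + 2 \<le> n"
  shows "real (n choose (l + 2)) / real ((n - l) choose 2) = real ((n + 2) choose (l + 2)) / real ((n + 2) choose 2)"
proof -
  have pos: "(n - l) choose 2 > 0" "(n + 2) choose 2 > 0" "(l + 2) choose 2 > 0"
    using assms by (auto simp: zero_less_binomial)
  have "(n choose (l + 2)) * ((l + 2) choose l) = (n choose l) * ((n - l) choose (l + 2 - l))"
    using assms by (intro choose_mult) auto
  moreover have "(l + 2) choose l = (l + 2) choose 2"
    using binomial_symmetric[of 2 "l + 2"] by simp
  ultimately have "(n choose (l + 2)) * ((l + 2) choose 2) = (n choose l) * ((n - l) choose 2)" by simp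
  then have 1: "real (n choose (l + 2)) * real ((l + 2) choose 2) = real (n choose l) * real ((n - l) choose 2)"
    by (simp only: of_nat_mult[symmetric])
  have "((n + 2) choose (l + 2)) * ((l + 2) choose 2) = ((n + 2) choose 2) * ((n + 2 - 2) choose (l + 2 - 2))"
    using assms by (intro choose_mult) auto
  then have 2: "real ((n + 2) choose (l + 2)) * real ((l + 2) choose 2) = real ((n + 2) choose 2) * real (n choose l)"
    by (simp only: of_nat_mult[symmetric] add_diff_cancel_right')
  define a b c d e f where "a = real (n choose (l + 2))" and "b = real ((n - l) choose 2)"
    and "c = real ((n + 2) choose (l + 2))" and "d = real ((n + 2) choose 2)"
    and "e = real ((l + 2) choose 2)" and "f = real (n choose l)"
  have "b > 0" "d > 0" "e > 0" "a * e = f * b" "c * e = d * f"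
    using pos 1 2 by (simp_all only: a_def b_def c_def d_def e_def f_def of_nat_0_less_iff)
  then have "a / b = f / e" "c / d = f / e" by (simp_all add: field_simps)
  then show ?thesis by (simp only: a_def b_def c_def d_def)
qed

text \<open>The bound has order 4^h log h / h^2. As N is at least 4^h / (2 sqrt h), this is of lower
  order than N / h, the scale of the gains.\<close>

lemma sum_level_error_le:
  assumes "h \<ge> 1"
  shows "(\<Sum>l=1..h-1. level_error (2 * h) l)
    \<le> 3 * log 2 (real h + 2) * 4 ^ (h + 1) / ((real h + 1) * (2 * real h + 1))"
proof -
  let ?c = "3 * log 2 (real h + 2)" and ?D = "real ((2 * h + 2) choose 2)"
  have D: "?D = (real h + 1) * (2 * real h + 1)"
    unfolding real_choose_two by (simp add: algebra_simps)
  have "(\<Sum>l=1..h-1. level_error (2 * h) l) \<le> (\<Sum>l=1..h-1. ?c / ?D * real ((2 * h + 2) choose (l + 2)))"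
  proof (intro sum_mono)
    fix l assume "l \<in> {1..h-1}"
    then have l: "l + 2 \<le> 2 * h" "l + 3 \<le> h + 2" by auto
    have "level_error (2 * h) l = real ((2 * h + 2) choose (l + 2)) / ?D * (3 * log 2 (real l + 3))"
      unfolding level_error_def binomial_layer_ratio[OF l(1), symmetric] by simp
    also have "\<dots> \<le> real ((2 * h + 2) choose (l + 2)) / ?D * ?c"
      using l by (intro mult_left_mono) auto
    finally show "level_error (2 * h) l \<le> ?c / ?D * real ((2 * h + 2) choose (l + 2))"
      by (simp only: mult_ac times_divide_eq_left times_divide_eq_right)
  qed
  also have "\<dots> = ?c / ?D * real (\<Sum>l=1..h-1. (2 * h + 2) choose (l + 2))"
    by (simp only: sum_distrib_left of_nat_sum)
  also have "\<dots> \<le> ?c / ?D * real (4 ^ (h + 1))"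
  proof (intro mult_left_mono of_nat_mono)
    have "(\<Sum>l=1..h-1. (2 * h + 2) choose (l + 2)) = (\<Sum>m\<in>(\<lambda>l. l + 2) ` {1..h-1}. (2 * h + 2) choose m)"
      by (subst sum.reindex) (auto simp: inj_on_def)
    also have "\<dots> \<le> (\<Sum>m\<le>2 * h + 2. (2 * h + 2) choose m)"
      using assms by (intro sum_mono2) auto
    also have "\<dots> = 2 ^ (2 * h + 2)" by (rule choose_row_sum)
    also have "\<dots> = 4 ^ (h + 1)" by (simp add: power_mult)
    finally show "(\<Sum>l=1..h-1. (2 * h + 2) choose (l + 2)) \<le> 4 ^ (h + 1)" .
  qed (use D in auto)
  finally show ?thesis unfolding D by simp
qed

text \<open>Consecutive central coefficients have ratio 2 (2h + 1) / (h + 1), and 4 h (h + 1) is at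
  most (2h + 1)^2.\<close>

lemma central_binomial_square_ge:
  assumes "h \<ge> 1"
  shows "16 ^ h \<le> 4 * h * (2 * h choose h)\<^sup>2"
  using assms
proof (induction h rule: dec_induct)
  case base
  show ?case by simp
next
  case (step h)
  let ?a = "2 * h choose h" and ?b = "2 * Suc h choose Suc h"
  have "Suc h * ?b = 2 * (2 * h + 1) * ?a"
  proof -
    define c where "c = (2 * h + 1) choose Suc h"
    have e: "Suc (2 * h + 1) = 2 * Suc h" by simp
    have "Suc h * (Suc (2 * h + 1) choose Suc h) = Suc (2 * h + 1) * ((2 * h + 1) choose h)"
      by (rule Suc_times_binomial)
    moreover have "(2 * h + 1) choose h = c"
      unfolding c_def using binomial_symmetric[of h "2 * h + 1"] by simp
    ultimately have "Suc h * ?b = 2 * (Suc h * c)" unfolding e by (simp only: mult_ac)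
    moreover have "Suc h * (Suc (2 * h) choose Suc h) = Suc (2 * h) * (2 * h choose h)"
      by (rule Suc_times_binomial)
    then have "Suc h * c = (2 * h + 1) * ?a" unfolding c_def by (simp only: Suc_eq_plus1)
    ultimately show ?thesis by (simp only: mult.assoc)
  qed
  then have sq: "(Suc h)\<^sup>2 * ?b\<^sup>2 = 4 * (2 * h + 1)\<^sup>2 * ?a\<^sup>2"
    by (metis (no_types, lifting) mult.assoc power_mult_distrib power2_eq_square mult_2 numeral_Bit0 mult.left_commute)
  have "Suc h * h * 16 ^ Suc h \<le> Suc h * h * (16 * (4 * h * ?a\<^sup>2))"
    using step.IH by (intro mult_left_mono) auto
  also have "\<dots> = h * (4 * h * Suc h * 4) * (4 * ?a\<^sup>2)" by (simp add: algebra_simps)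
  also have "\<dots> \<le> h * (4 * (2 * h + 1)\<^sup>2) * (4 * ?a\<^sup>2)"
    by (intro mult_right_mono mult_left_mono) (auto simp: power2_eq_square)
  also have "\<dots> = 4 * h * ((Suc h)\<^sup>2 * ?b\<^sup>2)" unfolding sq by simp
  also have "\<dots> = Suc h * h * (4 * Suc h * ?b\<^sup>2)" by (simp only: power2_eq_square mult_ac)
  finally show ?case using step.hyps by (simp only: mult_le_cancel1) simp
qed

section \<open>A single missing set\<close>

lemma mem_up_families:
  assumes "U \<in> up_families E h"
  shows "\<And>S. S \<in> U \<Longrightarrow> S \<subseteq> E \<and> S \<noteq> {} \<and> card S \<le> h"
    and "\<And>S T. S \<in> U \<Longrightarrow> S \<subseteq> T \<Longrightarrow> T \<subseteq> E \<Longrightarrow> card T \<le> h \<Longrightarrow> T \<in> U"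
  using assms unfolding up_families_def by blast+

lemma up_families_Un:
  assumes "U \<in> up_families E h" "V \<in> up_families E h"
  shows "U \<union> V \<in> up_families E h"
  using mem_up_families[OF assms(1)] mem_up_families[OF assms(2)]
  by (intro up_familiesI) (metis Un_iff)+

lemma up_families_Int:
  assumes "U \<in> up_families E h" "V \<in> up_families E h"
  shows "U \<inter> V \<in> up_families E h"
  using mem_up_families[OF assms(1)] mem_up_families[OF assms(2)]
  by (intro up_familiesI) (metis Int_iff)+

lemma finite_Union_up_families:
  assumes "finite E"
  shows "finite (\<Union>(up_families E h))"
  by (rule finite_subset[of _ "Pow E"]) (use assms in \<open>auto simp: up_families_def\<close>)

lemma empty_in_up_families: "{} \<in> up_families E h"
  by (intro up_familiesI) auto

lemma card_up_families_pos:
  assumes "finite E"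
  shows "card (up_families E h) > 0"
  using assms empty_in_up_families[of E h] by (auto simp: card_gt_0_iff)

lemma card_up_families_ge:
  assumes "finite E" "h > 0"
  shows "2 ^ (card E choose h) \<le> card (up_families E h)"
proof -
  have "Pow (layer E h) \<subseteq> up_families E h"
  proof
    fix V assume "V \<in> Pow (layer E h)"
    then have V: "S \<subseteq> E" "card S = h" if "S \<in> V" for S using that by (auto simp: layer_def)
    show "V \<in> up_families E h"
    proof (rule up_familiesI)
      fix S assume "S \<in> V"
      then show "S \<subseteq> E \<and> S \<noteq> {} \<and> card S \<le> h" using V[of S] assms(2) by auto
    next
      fix S T assume *: "S \<in> V" "S \<subseteq> T" "T \<subseteq> E" "card T \<le> h"
      then have "finite T" using assms(1) finite_subset by auto
      then have "S = T" using card_seteq[of T S] * V(2)[OF *(1)] by simp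
      then show "T \<in> V" using * by simp
    qed
  qed
  then have "card (Pow (layer E h)) \<le> card (up_families E h)"
    using assms by (intro card_mono) auto
  then show ?thesis using assms by (simp add: card_Pow)
qed

lemma card_up_families_truncate:
  assumes E: "finite E" and h: "h \<le> card E" and R: "\<And>A. A \<in> R \<Longrightarrow> card A \<le> h"
  defines "T \<equiv> {S. S \<subseteq> E \<and> h < card S}"
  shows "card {U\<in>up_families E (card E). R \<subseteq> U \<and> T \<subseteq> U} = card {U\<in>up_families E h. R \<subseteq> U}"
proof -
  have "bij_betw (\<lambda>U. U - T) {U\<in>up_families E (card E). R \<subseteq> U \<and> T \<subseteq> U} {U\<in>up_families E h. R \<subseteq> U}"
  proof (rule bij_betwI[where g = "\<lambda>U. U \<union> T"])
    show "(\<lambda>U. U - T) \<in> {U\<in>up_families E (card E). R \<subseteq> U \<and> T \<subseteq> U} \<rightarrow> {U\<in>up_families E h. R \<subseteq> U}"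
    proof (intro Pi_I CollectI conjI)
      fix U assume U: "U \<in> {U\<in>up_families E (card E). R \<subseteq> U \<and> T \<subseteq> U}"
      then have "U \<in> up_families E (card E)" by simp
      note m = mem_up_families[OF this]
      show "U - T \<in> up_families E h"
      proof (rule up_familiesI)
        fix S assume "S \<in> U - T"
        then show "S \<subseteq> E \<and> S \<noteq> {} \<and> card S \<le> h" using m(1)[of S] by (auto simp: T_def)
      next
        fix S S' assume *: "S \<in> U - T" "S \<subseteq> S'" "S' \<subseteq> E" "card S' \<le> h"
        then show "S' \<in> U - T" using m(2)[of S S'] h by (auto simp: T_def)
      qed
      show "R \<subseteq> U - T" using U R by (fastforce simp: T_def)
    qed
    show "(\<lambda>U. U \<union> T) \<in> {U\<in>up_families E h. R \<subseteq> U} \<rightarrow> {U\<in>up_families E (card E). R \<subseteq> U \<and> T \<subseteq> U}"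
    proof (intro Pi_I CollectI conjI)
      fix U assume U: "U \<in> {U\<in>up_families E h. R \<subseteq> U}"
      then have "U \<in> up_families E h" by simp
      note m = mem_up_families[OF this]
      show "U \<union> T \<in> up_families E (card E)"
      proof (rule up_familiesI)
        fix S assume S: "S \<in> U \<union> T"
        then have "S \<subseteq> E" using m(1)[of S] by (auto simp: T_def)
        then show "S \<subseteq> E \<and> S \<noteq> {} \<and> card S \<le> card E" using m(1)[of S] S E by (auto simp: T_def intro: card_mono)
      next
        fix S S' assume *: "S \<in> U \<union> T" "S \<subseteq> S'" "S' \<subseteq> E" "card S' \<le> card E"
        have "card S \<le> card S'" using * E by (meson card_mono finite_subset)
        then show "S' \<in> U \<union> T"
          using m(2)[of S S'] * by (cases "card S' \<le> h") (auto simp: T_def)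
      qed
      show "R \<subseteq> U \<union> T" using U by auto
    qed simp
    fix U
    show "U - T \<union> T = U" if "U \<in> {U\<in>up_families E (card E). R \<subseteq> U \<and> T \<subseteq> U}" using that by auto
    show "U \<union> T - T = U" if "U \<in> {U\<in>up_families E h. R \<subseteq> U}"
    proof -
      have "U \<inter> T = {}" using that mem_up_families(1)[of U E h] by (fastforce simp: T_def)
      then show ?thesis by auto
    qed
  qed
  then show ?thesis by (rule bij_betw_same_card)
qed

text \<open>Conditioning on all sets of size greater than \<open>h\<close> only makes \<open>A \<in> U\<close> more likely.\<close>

lemma up_families_truncate_le:
  assumes E: "finite E" and h: "h \<le> card E" and A: "card A \<le> h"
  shows "card {U\<in>up_families E (card E). A \<in> U} / card (up_families E (card E))
    \<le> card {U\<in>up_families E h. A \<in> U} / card (up_families E h)"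
proof -
  let ?L = "up_families E (card E)" and ?T = "{S. S \<subseteq> E \<and> h < card S}"
  have 1: "card {U\<in>?L. A \<in> U \<and> ?T \<subseteq> U} = card {U\<in>up_families E h. A \<in> U}"
    using card_up_families_truncate[OF E h, of "{A}"] A by simp
  have 2: "card {U\<in>?L. ?T \<subseteq> U} = card (up_families E h)"
    using card_up_families_truncate[OF E h, of "{}"] by simp
  have "card {U\<in>?L. A \<in> U} * card {U\<in>?L. ?T \<subseteq> U} \<le> card {U\<in>?L. A \<in> U \<and> ?T \<subseteq> U} * card ?L"
    by (intro harris_upsets finite_Union_up_families E up_families_Un up_families_Int) auto
  then have "card {U\<in>?L. A \<in> U} * card (up_families E h) \<le> card {U\<in>up_families E h. A \<in> U} * card ?L"
    unfolding 1 2 .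
  then have "real (card {U\<in>?L. A \<in> U}) * real (card (up_families E h))
    \<le> real (card {U\<in>up_families E h. A \<in> U}) * real (card ?L)"
    by (simp only: of_nat_mult[symmetric] of_nat_le_iff)
  then show ?thesis
    using card_up_families_pos[OF E, of h] card_up_families_pos[OF E, of "card E"]
    by (simp add: divide_simps)
qed

text \<open>A permutation of \<open>E\<close> carrying \<open>A\<close> to \<open>B\<close> acts
  injectively on up-sets.\<close>

lemma card_up_families_mem_le:
  assumes E: "finite E" and AB: "A \<subseteq> E" "B \<subseteq> E" "card A = card B"
  shows "card {U\<in>up_families E h. A \<in> U} \<le> card {U\<in>up_families E h. B \<in> U}"
proof -
  have fin: "finite A" "finite B" using AB E finite_subset by auto
  obtain f1 where f1: "bij_betw f1 A B" using finite_same_card_bij[OF fin AB(3)] by auto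
  have "card (E - A) = card (E - B)" using AB fin by (simp add: card_Diff_subset)
  then obtain f2 where f2: "bij_betw f2 (E - A) (E - B)"
    using finite_same_card_bij[of "E - A" "E - B"] E by auto
  define f where "f = (\<lambda>x. if x \<in> A then f1 x else f2 x)"
  have fA: "bij_betw f A B" using f1 by (subst bij_betw_cong[of A f f1]) (auto simp: f_def)
  have "bij_betw f (E - A) (E - B)" using f2 by (subst bij_betw_cong[of "E - A" f f2]) (auto simp: f_def)
  from bij_betw_combine[OF fA this] have f: "bij_betw f E E" using AB by (auto simp: Un_absorb1)
  then have inj: "inj_on f E" and img: "f ` E = E" by (auto simp: bij_betw_def)
  have cardf: "card (f ` S) = card S" if "S \<subseteq> E" for S
    using card_image inj inj_on_subset that by blast
  have "(\<lambda>U. (`) f ` U) ` {U\<in>up_families E h. A \<in> U} \<subseteq> {U\<in>up_families E h. B \<in> U}"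
  proof (intro image_subsetI CollectI conjI)
    fix U assume U: "U \<in> {U\<in>up_families E h. A \<in> U}"
    then have "U \<in> up_families E h" by simp
    note m = mem_up_families[OF this]
    show "B \<in> (`) f ` U" using U fA by (auto simp: bij_betw_def)
    show "(`) f ` U \<in> up_families E h"
    proof (rule up_familiesI)
      fix S assume "S \<in> (`) f ` U"
      then obtain S' where "S' \<in> U" "S = f ` S'" by auto
      then show "S \<subseteq> E \<and> S \<noteq> {} \<and> card S \<le> h" using m(1)[of S'] cardf[of S'] img by auto
    next
      fix S T assume *: "S \<in> (`) f ` U" "S \<subseteq> T" "T \<subseteq> E" "card T \<le> h"
      then obtain S' where S': "S' \<in> U" "S = f ` S'" by auto
      define T' where "T' = {x\<in>E. f x \<in> T}"
      have T': "T' \<subseteq> E" "f ` T' = T" using * img by (auto simp: T'_def)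
      have "S' \<subseteq> T'" using m(1)[OF S'(1)] S'(2) * by (auto simp: T'_def)
      then have "T' \<in> U" using m(2)[OF S'(1), of T'] T' cardf[of T'] * by auto
      then show "T \<in> (`) f ` U" using T'(2) by auto
    qed
  qed
  moreover have "inj_on (\<lambda>U. (`) f ` U) {U\<in>up_families E h. A \<in> U}"
  proof (rule inj_on_subset)
    show "inj_on (\<lambda>U. (`) f ` U) (Pow (Pow E))"
      by (intro inj_on_image_Pow inj)
    show "{U\<in>up_families E h. A \<in> U} \<subseteq> Pow (Pow E)" using mem_up_families(1) by blast
  qed
  ultimately show ?thesis using E by (intro card_inj_on_le[of "\<lambda>U. (`) f ` U"]) auto
qed

lemma central_binomial_ge_sqrt:
  assumes "h \<ge> 1"
  shows "4 ^ h / (2 * sqrt (real h)) \<le> real (2 * h choose h)"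
proof -
  have "real (16 ^ h) \<le> real (4 * h * (2 * h choose h)\<^sup>2)"
    by (rule of_nat_mono[OF central_binomial_square_ge[OF assms]])
  then have "16 ^ h \<le> 4 * real h * (real (2 * h choose h))\<^sup>2" by simp
  also have "\<dots> = (2 * sqrt (real h) * real (2 * h choose h))\<^sup>2" by (simp add: power_mult_distrib)
  also have "(16::real) ^ h = (4 ^ h)\<^sup>2" by (simp add: power_mult_distrib[symmetric] power2_eq_square)
  finally have "4 ^ h \<le> 2 * sqrt (real h) * real (2 * h choose h)"
    by (rule power2_le_imp_le) simp
  then show ?thesis using assms by (simp add: field_simps)
qed

text \<open>If the bound failed for one \<open>A\<close>, it would fail for all by symmetry. Choose \<open>m \<approx> N \<rho> / (h + 2 choose 2)\<close>
  sets \<open>A\<close> with \<open>\<rho> = 1/100\<close>, whose supersets cover the fraction \<open>r = \<rho> - \<rho>\<^sup>2 / 2\<close> of the middle layer, where \<open>N\<close> is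
  its size. By Harris they all lie in \<open>U\<close> with probability at least \<open>2 powr (- 4.2 \<rho> N / h)\<close>, up to lower order
  terms, while counting gives at most \<open>2 powr (- (\<kappa> + 2 r) N / h)\<close> where \<open>\<kappa> + 2 r \<approx> 4.5 \<rho>\<close>.\<close>

lemma eventually_up_families_mem_bound:
  "\<forall>\<^sub>F h in sequentially. \<forall>A\<in>layer {1..2 * h} (h - 2).
     real (card {U\<in>up_families {1..2 * h} h. A \<in> U}) / card (up_families {1..2 * h} h) < 2 powr (- (21/10) * real h)"
proof -
  have "\<forall>\<^sub>F h in sequentially. real h + 1 \<le> 2 powr ((real h + 1) / 16)" by real_asymp
  \<comment> \<open>This and the next estimate reserve \<open>1/2000 * ?N / (h + 1)\<close> each for
    the layer errors and for rounding \<open>m\<close> up.\<close>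
  moreover have "\<forall>\<^sub>F h in sequentially. 24 * log 2 (real h + 2) * sqrt (real h) / (2 * real h + 1) \<le> 1/2000"
    by real_asymp
  moreover have "\<forall>\<^sub>F h in sequentially. 21/10 * real h * (real h + 1) * (2 * sqrt (real h)) / 4 ^ h \<le> 1/2000"
    by real_asymp
  ultimately show ?thesis
    using eventually_ge_at_top[of 1000]
  proof eventually_elim
    case (elim h)
    note large = elim(1) and err_small = elim(2) and round_small = elim(3) and h = elim(4)
    let ?E = "{1..2 * h}" and ?N = "real (2 * h choose h)"
    let ?L = "up_families ?E h"
    let ?P = "2 powr (- (21/10) * real h)"
    have E: "finite ?E" "card ?E = 2 * h" by simp_all
    have N: "?N > 0" by (simp add: zero_less_binomial)
    have posL: "card ?L > 0" by (rule card_up_families_pos) simp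
    show ?case
    proof (rule ccontr)
      assume "\<not> ?case"
      then obtain A0 where A0: "A0 \<in> layer ?E (h - 2)" "?P \<le> real (card {U\<in>?L. A0 \<in> U}) / card ?L" by force
      have all: "?P \<le> real (card {U\<in>?L. A \<in> U}) / card ?L" if "A \<in> layer ?E (h - 2)" for A
      proof -
        have "card {U\<in>?L. A0 \<in> U} \<le> card {U\<in>?L. A \<in> U}"
          using A0(1) that by (intro card_up_families_mem_le) (auto simp: layer_def)
        then have "real (card {U\<in>?L. A0 \<in> U}) / card ?L \<le> real (card {U\<in>?L. A \<in> U}) / card ?L"
          by (intro divide_right_mono) auto
        then show ?thesis using A0(2) by linarith
      qed
      \<comment> \<open>The fraction of the middle layer above one set \<open>A\<close>.\<close>
      define q where "q = real (h choose (h - 2)) / real (2 * h choose (h - 2))"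
      have q: "q = real ((h + 2) choose 2) / ?N"
      proof -
        have "(2 * h choose h) * (h choose (h - 2)) = (2 * h choose (h - 2)) * ((2 * h - (h - 2)) choose (h - (h - 2)))"
          by (rule choose_mult) auto
        also have "2 * h - (h - 2) = h + 2" using h by auto
        also have "h - (h - 2) = 2" using h by auto
        finally have "?N * real (h choose (h - 2)) = real (2 * h choose (h - 2)) * real ((h + 2) choose 2)"
          by (simp only: of_nat_mult[symmetric])
        moreover have "real (2 * h choose (h - 2)) > 0" by (simp add: zero_less_binomial)
        ultimately show ?thesis using N unfolding q_def by (simp add: field_simps)
      qed
      have c2: "real ((h + 2) choose 2) = (real h + 2) * (real h + 1) / 2"
        unfolding real_choose_two by (simp add: algebra_simps)
      have q0: "q > 0" unfolding q c2 using N by simp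
      have q1: "q \<le> 1" 
        unfolding q_def by (intro divide_le_eq_1[THEN iffD2]) (auto simp: zero_less_binomial intro!: binomial_right_mono)
      \<comment> \<open>Chosen so that without overlaps the supersets would fill about 1/100 of the
        middle layer.\<close>
      define m where "m = nat \<lceil>1/100 / q\<rceil>"
      have m: "1/100 / q \<le> real m" "real m \<le> 1/100 / q + 1"
        using q0 unfolding m_def by (auto simp: of_nat_nat intro: order_trans[OF _ le_of_int_ceiling])
      have "h - 2 + 2 \<le> card ?E" "h - 2 + 2 = h" using h by auto
      with greedy_cover[OF E(1) this(1), of m]
      obtain \<A> where \<A>: "\<A> \<subseteq> layer ?E (h - 2)" "card \<A> \<le> m"
        "real (card {Z\<in>layer ?E h. \<forall>A\<in>\<A>. \<not> A \<subseteq> Z}) \<le> ?N * (1 - q) ^ m"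
        unfolding q_def E(2) by auto
      define G0 where "G0 = {Z\<in>layer ?E h. \<exists>X\<in>\<A>. X \<subseteq> Z}"
      have G0: "real (card G0) \<ge> 995/100000 * ?N"
      proof -
        have "(1 - q) ^ m \<le> exp (- q) ^ m"
          using q1 exp_ge_add_one_self[of "- q"] by (intro power_mono) auto
        also have "\<dots> = exp (- (q * real m))" by (simp add: exp_of_nat_mult[symmetric] mult.commute)
        also have "\<dots> \<le> exp (- (1/100))" using m(1) q0 by (simp add: field_simps)
        \<comment> \<open>This is 1 - x + x^2/2 at x = 1/100, and (1 + x + x^2/2) (1 - x + x^2/2) =
          1 + x^4/4.\<close>
        also have "\<dots> \<le> 1 - 995/100000"
        proof -
          have "1 + 1/100 + (1/100)\<^sup>2 / 2 \<le> exp (1/100::real)" by (rule exp_lower_Taylor_quadratic) simp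
          then have "exp (- (1/100)) \<le> inverse (1 + 1/100 + (1/100)\<^sup>2 / 2 :: real)"
            unfolding exp_minus by (intro le_imp_inverse_le) (auto simp: power2_eq_square)
          also have "\<dots> \<le> 1 - 995/100000" by (simp add: power2_eq_square)
          finally show ?thesis .
        qed
        finally have "?N * (1 - q) ^ m \<le> ?N * (1 - 995/100000)"
          using N by (intro mult_left_mono) auto
        with \<A>(3) have "real (card {Z\<in>layer ?E h. \<forall>A\<in>\<A>. \<not> A \<subseteq> Z}) \<le> ?N * (1 - 995/100000)"
          by (rule order_trans)
        moreover have "card (G0 \<union> {Z\<in>layer ?E h. \<forall>A\<in>\<A>. \<not> A \<subseteq> Z})
            = card G0 + card {Z\<in>layer ?E h. \<forall>A\<in>\<A>. \<not> A \<subseteq> Z}"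
          by (rule card_Un_disjoint) (auto simp: G0_def)
        moreover have "G0 \<union> {Z\<in>layer ?E h. \<forall>A\<in>\<A>. \<not> A \<subseteq> Z} = layer ?E h"
          by (auto simp: G0_def)
        ultimately have "?N = real (card G0) + real (card {Z\<in>layer ?E h. \<forall>A\<in>\<A>. \<not> A \<subseteq> Z})"
          and "real (card {Z\<in>layer ?E h. \<forall>A\<in>\<A>. \<not> A \<subseteq> Z}) \<le> ?N * (1 - 995/100000)"
          by simp_all
        then show ?thesis by (simp add: algebra_simps)
      qed
      let ?r = "995/100000 :: real"
      define \<kappa> where "\<kappa> = 5/2 * ?r - 3/2 * ?r\<^sup>2"
      have \<kappa>: "\<kappa> * ?N \<le> real g + 3/2 * real g * (?N - real g) / ?N" if "card G0 \<le> g" "g \<le> 2 * h choose h" for g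
      proof -
        define s where "s = real g / ?N"
        have g: "real g = s * ?N" using N by (simp add: s_def)
        have "?r \<le> s" using G0 that(1) N by (simp add: s_def field_simps)
        moreover have "s \<le> 1" using that(2) N by (simp add: s_def)
        \<comment> \<open>With s = g / N the required bound reads 5/2 s - 3/2 s^2, which equals
          \<kappa> at s = r; the difference factors, and s + r stays below 5/3.\<close>
        ultimately have "0 \<le> (s - ?r) * (5/2 - 3/2 * (s + ?r))" by (intro mult_nonneg_nonneg) auto
        moreover have "(s - r) * (5/2 - 3/2 * (s + r)) = s + 3/2 * s * (1 - s) - (5/2 * r - 3/2 * r\<^sup>2)" for r
          by (simp add: power2_eq_square field_simps)
        ultimately have "\<kappa> \<le> s + 3/2 * s * (1 - s)" unfolding \<kappa>_def by (simp only: diff_ge_0_iff_ge)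
        then have "\<kappa> * ?N \<le> (s + 3/2 * s * (1 - s)) * ?N" using N by (intro mult_right_mono) auto
        also have "\<dots> = real g + 3/2 * real g * (?N - real g) / ?N"
          unfolding g using N by (simp add: field_simps)
        finally show ?thesis .
      qed
      let ?err = "\<Sum>l=1..h-1. level_error (2 * h) l"
      let ?x = "- \<kappa> * ?N / (real h + 1) - (real h + 1) * card G0 / real ((h + 2) choose 2) + ?err"
      have "h = (h - 3) + 3" using h by simp
      from card_up_families_containing_le[OF E this \<A>(1), folded G0_def, OF \<kappa> large]
      have upper: "real (card {U\<in>?L. \<A> \<subseteq> U}) \<le> 2 powr (?N + ?x)" by (simp add: algebra_simps)
      have "2 powr (- (21/10) * real h * real m) = ?P ^ m"
        by (simp add: powr_powr powr_realpow[symmetric])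
      \<comment> \<open>Having fewer than \<open>m\<close> sets is harmless since
        \<open>?P \<le> 1\<close>.\<close>
      also have "\<dots> \<le> ?P ^ card \<A>"
        using \<A>(2) powr_mono[of "- (21/10) * real h" 0 "2::real"] by (intro power_decreasing) auto
      also have "\<dots> = (\<Prod>A\<in>\<A>. ?P)" by simp
      also have "\<dots> \<le> (\<Prod>A\<in>\<A>. real (card {U\<in>?L. A \<in> U}) / card ?L)"
        using all \<A>(1) by (intro prod_mono) auto
      also have "\<dots> \<le> card {U\<in>?L. \<A> \<subseteq> U} / card ?L"
      proof (rule harris_upsets_prod)
        show "finite (\<Union>?L)" by (rule finite_Union_up_families) simp
        show "?L \<noteq> {}" using empty_in_up_families by blast
        show "finite \<A>" by (rule finite_subset[OF \<A>(1)]) simp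
      qed (auto intro: up_families_Un up_families_Int)
      also have "\<dots> \<le> 2 powr (?N + ?x) / 2 powr ?N"
      proof (intro frac_le upper)
        have "real (2 ^ (2 * h choose h)) \<le> real (card ?L)"
          using card_up_families_ge[OF E(1), of h] h E(2) by (intro of_nat_mono) simp
        then show "2 powr ?N \<le> real (card ?L)" by (simp add: powr_realpow)
      qed auto
      also have "\<dots> = 2 powr ?x" by (simp add: powr_add)
      finally have "- (21/10) * real h * real m \<le> ?x" by simp
      moreover have "(real h + 1) * card G0 / real ((h + 2) choose 2) = 2 * card G0 / (real h + 2)"
      proof -
        have "(x + 1) * y / ((x + 2) * (x + 1) / 2) = 2 * y / (x + 2)" if "x \<ge> 0" for x y :: real
          using that by (simp add: divide_simps)
        then show ?thesis unfolding c2 by simp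
      qed
      ultimately have "\<kappa> * ?N / (real h + 1) + 2 * card G0 / (real h + 2) \<le> 21/10 * real h * real m + ?err"
        by simp
      moreover have "2 * (?r * ?N) / (real h + 2) \<le> 2 * card G0 / (real h + 2)"
        using G0 by (intro divide_right_mono) auto
      moreover have "21/10 * real h * real m \<le> 21/10 * real h * (1/50 * ?N / ((real h + 2) * (real h + 1)) + 1)"
      proof (intro mult_left_mono)
        have "1/100 / q = 1/50 * ?N / ((real h + 2) * (real h + 1))" unfolding q c2 by simp
        then show "real m \<le> 1/50 * ?N / ((real h + 2) * (real h + 1)) + 1" using m(2) by simp
      qed simp
      moreover have "?err \<le> 3 * log 2 (real h + 2) * 4 ^ (h + 1) / ((real h + 1) * (2 * real h + 1))"
        using h by (intro sum_level_error_le) auto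
      ultimately have main: "\<kappa> * ?N / (real h + 1) + 2 * (?r * ?N) / (real h + 2)
        \<le> 21/10 * real h * (1/50 * ?N / ((real h + 2) * (real h + 1)) + 1)
          + 3 * log 2 (real h + 2) * 4 ^ (h + 1) / ((real h + 1) * (2 * real h + 1))"
        by linarith
      have H: "real h \<ge> 1000" using h by simp
      have Nlow: "4 ^ h / (2 * sqrt (real h)) \<le> ?N" using h by (intro central_binomial_ge_sqrt) auto
      then have Nlow': "4 ^ h \<le> 2 * sqrt (real h) * ?N" using H by (simp add: field_simps)
      have e1: "3 * log 2 (real h + 2) * 4 ^ (h + 1) / ((real h + 1) * (2 * real h + 1)) \<le> (1/2000 * ?N) / (real h + 1)"
      proof -
        have "3 * log 2 (real h + 2) * 4 ^ (h + 1) / (2 * real h + 1)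
          = 12 * log 2 (real h + 2) / (2 * real h + 1) * 4 ^ h" by simp
        also have "\<dots> \<le> 12 * log 2 (real h + 2) / (2 * real h + 1) * (2 * sqrt (real h) * ?N)"
          by (intro mult_left_mono Nlow') (auto intro!: divide_nonneg_nonneg)
        also have "\<dots> = 24 * log 2 (real h + 2) * sqrt (real h) / (2 * real h + 1) * ?N" by simp
        also have "\<dots> \<le> 1/2000 * ?N" using err_small by (intro mult_right_mono) auto
        finally have "3 * log 2 (real h + 2) * 4 ^ (h + 1) / (2 * real h + 1) / (real h + 1) \<le> (1/2000 * ?N) / (real h + 1)"
          by (intro divide_right_mono) auto
        then show ?thesis by (simp only: divide_divide_eq_left mult.commute)
      qed
      have e2: "21/10 * real h \<le> (1/2000 * ?N) / (real h + 1)"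
      proof -
        have "21/10 * real h * (real h + 1) * (2 * sqrt (real h)) \<le> 1/2000 * 4 ^ h"
          using round_small by (simp add: divide_le_eq)
        also have "\<dots> \<le> 1/2000 * (2 * sqrt (real h) * ?N)" by (intro mult_left_mono Nlow') auto
        finally have "(21/10 * real h * (real h + 1)) * (2 * sqrt (real h)) \<le> (1/2000 * ?N) * (2 * sqrt (real h))"
          by (simp add: mult_ac)
        then have "21/10 * real h * (real h + 1) \<le> 1/2000 * ?N"
          using H by (subst (asm) mult_le_cancel_right) auto
        moreover have "real h + 1 > 0" by simp
        ultimately show ?thesis by (simp only: pos_le_divide_eq)
      qed
      \<comment> \<open>Lowering 2 r = 199/10000 to 198/10000 pays for replacing h + 2 by h + 1,
        given that h is at least 1000.\<close>
      have e3: "2 * (?r * ?N) / (real h + 2) \<ge> (198/10000 * ?N) / (real h + 1)"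
      proof -
        have "198/10000 * (real h + 2) \<le> 2 * ?r * (real h + 1)" using H by (simp add: algebra_simps)
        then have "198/10000 * (real h + 2) * ?N \<le> 2 * ?r * (real h + 1) * ?N" using N by (intro mult_right_mono) auto
        then show ?thesis using H by (simp add: divide_simps mult_ac)
      qed
      have e4: "21/10 * real h * (1/50 * ?N / ((real h + 2) * (real h + 1)) + 1) \<le> (42/1000 * ?N) / (real h + 1) + 21/10 * real h"
      proof -
        have "21/10 * real h * (1/50 * ?N / ((real h + 2) * (real h + 1)))
          = (real h / (real h + 2)) * ((42/1000 * ?N) / (real h + 1))"
          using H by (simp add: field_simps)
        also have "\<dots> \<le> 1 * ((42/1000 * ?N) / (real h + 1))"
          using N by (intro mult_right_mono) auto
        finally show ?thesis by (simp add: distrib_left)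
      qed
      define Q where "Q = ?N / (real h + 1)"
      have "Q > 0" using N by (simp add: Q_def)
      have "\<kappa> * ?N / (real h + 1) + (198/10000 * ?N) / (real h + 1)
        \<le> (42/1000 * ?N) / (real h + 1) + (1/2000 * ?N) / (real h + 1) + (1/2000 * ?N) / (real h + 1)"
        using main e1 e2 e3 e4 by linarith
      then have "\<kappa> * Q + 198/10000 * Q \<le> 42/1000 * Q + 1/2000 * Q + 1/2000 * Q"
        unfolding Q_def by (simp only: times_divide_eq_right)
      then have "(\<kappa> + 198/10000 - 43/1000) * Q \<le> 0" by (simp add: algebra_simps)
      \<comment> \<open>Numerically \<kappa> is about 0.0247, so the left side is about
        0.0015.\<close>
      moreover have "\<kappa> + 198/10000 - 43/1000 > 0" unfolding \<kappa>_def by (simp add: power2_eq_square)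
      ultimately show False using \<open>Q > 0\<close> by (simp add: mult_le_0_iff)
    qed
  qed
qed

section \<open>Random complexes\<close>

lemma complexes_bij_up_families:
  "bij_betw (\<lambda>\<Delta>. {S. S \<subseteq> {1..n} \<and> S \<noteq> {}} - \<Delta>) (complexes n) (up_families {1..n} n)"
proof (rule bij_betwI[where g = "\<lambda>U. {S. S \<subseteq> {1..n} \<and> S \<noteq> {}} - U"])
  show "(\<lambda>\<Delta>. {S. S \<subseteq> {1..n} \<and> S \<noteq> {}} - \<Delta>) \<in> complexes n \<rightarrow> up_families {1..n} n"
  proof (rule Pi_I, rule up_familiesI)
    fix \<Delta> S assume "S \<in> {S. S \<subseteq> {1..n} \<and> S \<noteq> {}} - \<Delta>"
    then show "S \<subseteq> {1..n} \<and> S \<noteq> {} \<and> card S \<le> n"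
      using card_mono[of "{1..n}" S] by auto
  next
    fix \<Delta> S T assume "\<Delta> \<in> complexes n" "S \<in> {S. S \<subseteq> {1..n} \<and> S \<noteq> {}} - \<Delta>" "S \<subseteq> T" "T \<subseteq> {1..n}"
    then show "T \<in> {S. S \<subseteq> {1..n} \<and> S \<noteq> {}} - \<Delta>"
      unfolding complexes_def simplicial_complex_def by blast
  qed
  show "(\<lambda>U. {S. S \<subseteq> {1..n} \<and> S \<noteq> {}} - U) \<in> up_families {1..n} n \<rightarrow> complexes n"
  proof
    fix U assume U: "U \<in> up_families {1..n} n"
    have "x \<in> U" if "y \<in> U" "y \<subseteq> x" "x \<subseteq> {1..n}" for x y
      using mem_up_families(2)[OF U that] card_mono[OF _ that(3)] by simp
    then show "{S. S \<subseteq> {1..n} \<and> S \<noteq> {}} - U \<in> complexes n"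
      unfolding complexes_def simplicial_complex_def by blast
  qed
next
  fix \<Delta> assume "\<Delta> \<in> complexes n"
  then show "{S. S \<subseteq> {1..n} \<and> S \<noteq> {}} - ({S. S \<subseteq> {1..n} \<and> S \<noteq> {}} - \<Delta>) = \<Delta>"
    unfolding complexes_def simplicial_complex_def by blast
next
  fix U assume "U \<in> up_families {1..n} n"
  then show "{S. S \<subseteq> {1..n} \<and> S \<noteq> {}} - ({S. S \<subseteq> {1..n} \<and> S \<noteq> {}} - U) = U"
    unfolding up_families_def by blast
qed

lemma card_complexes: "card (complexes n) = card (up_families {1..n} n)"
  by (rule bij_betw_same_card[OF complexes_bij_up_families])

lemma card_complexes_missing:
  assumes "A \<subseteq> {1..n}" "A \<noteq> {}"
  shows "card {\<Delta>\<in>complexes n. A \<notin> \<Delta>} = card {U\<in>up_families {1..n} n. A \<in> U}"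
proof -
  let ?f = "\<lambda>\<Delta>. {S. S \<subseteq> {1..n} \<and> S \<noteq> {}} - \<Delta>"
  have img: "?f ` {\<Delta>\<in>complexes n. A \<notin> \<Delta>} = {U\<in>up_families {1..n} n. A \<in> U}"
    unfolding bij_betw_imp_surj_on[OF complexes_bij_up_families, of n, symmetric] using assms by blast
  have inj: "inj_on ?f {\<Delta>\<in>complexes n. A \<notin> \<Delta>}"
    using bij_betw_imp_inj_on[OF complexes_bij_up_families, of n] by (rule inj_on_subset) auto
  show ?thesis unfolding img[symmetric] by (rule card_image[OF inj, symmetric])
qed

text \<open>Supersets of a missing set are missing, so a defect extends to size exactly
  \<open>k\<close> and the union bound runs over a single layer.\<close>

lemma not_complete_skeleton_subset:
  assumes "k \<le> n"
  shows "{\<Delta>\<in>complexes n. \<not> complete_skeleton n k \<Delta>} \<subseteq> (\<Union>A\<in>layer {1..n} k. {\<Delta>\<in>complexes n. A \<notin> \<Delta>})"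
proof
  fix \<Delta> assume "\<Delta> \<in> {\<Delta>\<in>complexes n. \<not> complete_skeleton n k \<Delta>}"
  then obtain s where \<Delta>: "\<Delta> \<in> complexes n" and s: "s \<subseteq> {1..n}" "s \<noteq> {}" "card s \<le> k" "s \<notin> \<Delta>"
    by (auto simp: complete_skeleton_def)
  obtain A where A: "s \<subseteq> A" "A \<subseteq> {1..n}" "card A = k"
    using exists_subset_between[of s k "{1..n}"] s assms by auto
  have "A \<notin> \<Delta>" using \<Delta> s A unfolding complexes_def simplicial_complex_def by blast
  then show "\<Delta> \<in> (\<Union>A\<in>layer {1..n} k. {\<Delta>\<in>complexes n. A \<notin> \<Delta>})"
    using \<Delta> A by (auto simp: layer_def)
qed

lemma eventually_prob_complete_skeleton_ge:
  "\<forall>\<^sub>F h in sequentially. 1 - 2 powr (- real h / 10) \<le>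
     measure_pmf.prob (uniform_complex (2 * h)) {\<Delta>. complete_skeleton (2 * h) (h - 2) \<Delta>}"
  using eventually_up_families_mem_bound eventually_ge_at_top[of 3]
proof eventually_elim
  case (elim h)
  let ?C = "complexes (2 * h)" and ?E = "{1..2 * h}"
  let ?B = "{\<Delta>\<in>?C. \<not> complete_skeleton (2 * h) (h - 2) \<Delta>}"
  have C: "finite ?C" "?C \<noteq> {}" by (rule finite_complexes complexes_nonempty)+
  then have pos: "real (card ?C) > 0" by (simp add: card_gt_0_iff)
  have each: "real (card {\<Delta>\<in>?C. A \<notin> \<Delta>}) \<le> 2 powr (- (21/10) * real h) * card ?C" if A: "A \<in> layer ?E (h - 2)" for A
  proof -
    \<comment> \<open>From h at least 3 the size h - 2 is positive, so \<open>A\<close> is non-empty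
      and can be a member of an up-set.\<close>
    have A': "A \<subseteq> ?E" "A \<noteq> {}" "card A \<le> h" using A elim(2) by (auto simp: layer_def)
    have "card {\<Delta>\<in>?C. A \<notin> \<Delta>} / card ?C = card {U\<in>up_families ?E (2 * h). A \<in> U} / card (up_families ?E (2 * h))"
      unfolding card_complexes card_complexes_missing[OF A'(1,2)] ..
    also have "\<dots> \<le> card {U\<in>up_families ?E h. A \<in> U} / card (up_families ?E h)"
      using up_families_truncate_le[of ?E h A] A'(3) by simp
    also have "\<dots> \<le> 2 powr (- (21/10) * real h)" using elim(1) A by (auto intro: less_imp_le)
    finally show ?thesis using pos by (simp add: divide_le_eq)
  qed
  have "card ?B \<le> card (\<Union>A\<in>layer ?E (h - 2). {\<Delta>\<in>?C. A \<notin> \<Delta>})"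
    using C by (intro card_mono not_complete_skeleton_subset) auto
  also have "\<dots> \<le> (\<Sum>A\<in>layer ?E (h - 2). card {\<Delta>\<in>?C. A \<notin> \<Delta>})"
    by (rule card_UN_le) simp
  finally have "real (card ?B) \<le> (\<Sum>A\<in>layer ?E (h - 2). real (card {\<Delta>\<in>?C. A \<notin> \<Delta>}))"
    by (simp only: of_nat_sum[symmetric] of_nat_le_iff)
  also have "\<dots> \<le> (\<Sum>A\<in>layer ?E (h - 2). 2 powr (- (21/10) * real h) * card ?C)"
    by (intro sum_mono each)
  also have "\<dots> = real (2 * h choose (h - 2)) * (2 powr (- (21/10) * real h) * card ?C)" by simp
  also have "\<dots> \<le> 2 powr (2 * real h) * (2 powr (- (21/10) * real h) * card ?C)"
  proof (intro mult_right_mono)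
    have "2 * h choose (h - 2) \<le> 2 ^ (2 * h)" by (rule binomial_le_pow2)
    then have "real (2 * h choose (h - 2)) \<le> 2 ^ (2 * h)" by (metis of_nat_le_iff of_nat_numeral of_nat_power)
    also have "\<dots> = 2 powr (2 * real h)" by (simp add: powr_realpow[symmetric])
    finally show "real (2 * h choose (h - 2)) \<le> 2 powr (2 * real h)" .
  qed auto
  also have "\<dots> = 2 powr (- real h / 10) * card ?C"
    by (simp add: powr_add[symmetric] flip: mult.assoc)
  finally have bad: "real (card ?B) / card ?C \<le> 2 powr (- real h / 10)"
    using pos by (simp add: divide_le_eq)
  have "?C \<inter> {\<Delta>. complete_skeleton (2 * h) (h - 2) \<Delta>} = ?C - ?B" by auto
  then have "measure_pmf.prob (uniform_complex (2 * h)) {\<Delta>. complete_skeleton (2 * h) (h - 2) \<Delta>}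
    = real (card (?C - ?B)) / card ?C"
    using C by (simp add: uniform_complex_def measure_pmf_of_set)
  also have "real (card (?C - ?B)) = real (card ?C) - real (card ?B)"
    using C by (subst card_Diff_subset) (auto simp: of_nat_diff card_mono)
  also have "\<dots> / card ?C = 1 - real (card ?B) / card ?C" using pos by (simp add: diff_divide_distrib)
  finally show ?case using bad by linarith
qed

theorem theorem4:
  shows "((\<lambda>n::nat. measure_pmf.prob (uniform_complex n)
             {\<Delta>. complete_skeleton n (n div 2 - 2) \<Delta>}) \<longlongrightarrow> 1)
           (inf sequentially (principal {n. even n}))"
proof (rule tendsto_sandwich)
  have half: "filterlim (\<lambda>n::nat. n div 2) sequentially sequentially"
    unfolding filterlim_at_top
  proof
    fix Z :: nat
    show "\<forall>\<^sub>F n in sequentially. Z \<le> n div 2"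
      using eventually_ge_at_top[of "2 * Z"] by eventually_elim auto
  qed
  show "\<forall>\<^sub>F n in inf sequentially (principal {n. even n}). 1 - 2 powr (- real (n div 2) / 10) \<le>
      measure_pmf.prob (uniform_complex n) {\<Delta>. complete_skeleton n (n div 2 - 2) \<Delta>}"
    unfolding eventually_inf_principal
    \<comment> \<open>For even \<open>n\<close>, \<open>2 * (n div 2)\<close> is \<open>n\<close>,
      so the bound indexed by h applies.\<close>
    using eventually_compose_filterlim[OF eventually_prob_complete_skeleton_ge half]
    by eventually_elim auto
  show "\<forall>\<^sub>F n in inf sequentially (principal {n. even n}).
      measure_pmf.prob (uniform_complex n) {\<Delta>. complete_skeleton n (n div 2 - 2) \<Delta>} \<le> 1"
    by simp
  have "(\<lambda>h::nat. 1 - 2 powr (- real h / 10)) \<longlonglongrightarrow> 1" by real_asymp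
  then have "(\<lambda>n::nat. 1 - 2 powr (- real (n div 2) / 10)) \<longlonglongrightarrow> 1"
    by (rule filterlim_compose[OF _ half])
  then show "((\<lambda>n::nat. 1 - 2 powr (- real (n div 2) / 10)) \<longlongrightarrow> 1) (inf sequentially (principal {n. even n}))"
    by (rule tendsto_mono[OF inf_le1])
qed (rule tendsto_const)

end
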